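(* Assume complete randomization and that $V_{\hat\gamma}$ is nonsingular. There is a universal constant $C>0$ such that: (i) for every $b\in\mathbb R^H$ with $\|b\|_2=1$, $$\sup_{t\in\mathbb R}\big|\mathbb P\{b^\top\tilde\gamma\le t\}-\Phi(t)\big|\le C\,\big\|b^\top V_{\hat\gamma}^{-1/2}F^\top\big\|_\infty\cdot\max_{q\in[Q]}N_q^{-1}M_N(q),$$ where $\|x\|_\infty=\max_k|x_k|$ for a row vector $x$; (ii) if moreover Condition 1 holds with constant $\sigma_F$, then $$\sup_{b\in\mathbb R^H,\|b\|_2=1}\ \sup_{t\in\mathbb R}\big|\mathbb P\{b^\top\tilde\gamma\le t\}-\Phi(t)\big|\le C\max_{i\in[N],q\in[Q]}\min\{\mathrm I(i,q),\mathrm{II}(i,q)\},$$ where $\mathrm I(i,q)=\sigma_F\,\dfrac{|Y_i(q)-\overline Y(q)|}{\sqrt{N_qS(q,q)}}$ and $\mathrm{II}(i,q)=\dfrac{\|F(q,\cdot)\|_2\,N_q^{-1}|Y_i(q)-\overline Y(q)|}{\sqrt{\varrho_{\min}(F^\top V_{\hat Y}F)}}$.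
   Context: Randomization model: there are $N$ units and $Q$ treatment levels with prescribed group sizes $N_1,\dots,N_Q\ge1$, $\sum_{q=1}^QN_q=N$. Each unit $i\in[N]=\{1,\dots,N\}$ has fixed (non-random) real potential outcomes $Y_i(1),\dots,Y_i(Q)$. Under complete randomization the treatment vector $Z=(Z_1,\dots,Z_N)$ is uniformly distributed over all vectors in $[Q]^N$ having exactly $N_q$ coordinates equal to $q$ for each $q$; the observed outcome is $Y_i=Y_i(Z_i)$. Write $\overline Y(q)=N^{-1}\sum_iY_i(q)$, $\overline Y=(\overline Y(1),\dots,\overline Y(Q))^\top$, $S(q,q')=(N-1)^{-1}\sum_i(Y_i(q)-\overline Y(q))(Y_i(q')-\overline Y(q'))$, $S=(S(q,q'))_{q,q'\in[Q]}$, $\hat Y_q=N_q^{-1}\sum_{i:Z_i=q}Y_i$, $\hat Y=(\hat Y_1,\dots,\hat Y_Q)^\top$, and $V_{\hat Y}=\mathrm{diag}(N_q^{-1}S(q,q))_{q\in[Q]}-N^{-1}S$ (the covariance matrix of $\hat Y$). For a fixed matrix $F=(f_{qh})\in\mathbb R^{Q\times H}$ with rows $F(q,\cdot)$, let $\gamma=F^\top\overline Y$, $\hat\gamma=F^\top\hat Y$, $V_{\hat\gamma}=F^\top V_{\hat Y}F$ (assumed nonsingular) and $\tilde\gamma=V_{\hat\gamma}^{-1/2}(\hat\gamma-\gamma)$. Let $M_N(q)=\max_{i\in[N]}|Y_i(q)-\overline Y(q)|$, $\|F\|_\infty=\max_{q,h}|f_{qh}|$, $\varrho_{\min}(\cdot)$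 the smallest eigenvalue of a symmetric matrix, and $\Phi$ the standard normal cdf. Condition 1: there exists $\sigma_F\ge1$ such that $F^\top\mathrm{diag}(N_q^{-1}S(q,q))_{q\in[Q]}F\preceq\sigma_F^2F^\top V_{\hat Y}F$ in the Loewner order. *)

theory Defs
  imports "HOL-Probability.Probability" "Jordan_Normal_Form.Char_Poly"
begin

text \<open>Indexing conventions: units are 0..<N, treatment levels 0..<Q, columns of F are 0..<H
  (0-based versions of [N], [Q], [H]).  Potential outcomes: Y i q = Y_i(q).
  Group sizes: Nq q = N_q.\<close>

definition assignments :: "nat \<Rightarrow> nat \<Rightarrow> (nat \<Rightarrow> nat) \<Rightarrow> (nat \<Rightarrow> nat) set" where
  "assignments N Q Nq = {Z \<in> {..<N} \<rightarrow>\<^sub>E {..<Q}. \<forall>q<Q. card {i \<in> {..<N}. Z i = q} = Nq q}"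

definition CR :: "nat \<Rightarrow> nat \<Rightarrow> (nat \<Rightarrow> nat) \<Rightarrow> (nat \<Rightarrow> nat) pmf" where
  "CR N Q Nq = pmf_of_set (assignments N Q Nq)"

definition Ybar :: "nat \<Rightarrow> (nat \<Rightarrow> nat \<Rightarrow> real) \<Rightarrow> nat \<Rightarrow> real" where
  "Ybar N Y q = (\<Sum>i<N. Y i q) / real N"

definition Ybar_vec :: "nat \<Rightarrow> nat \<Rightarrow> (nat \<Rightarrow> nat \<Rightarrow> real) \<Rightarrow> real vec" where
  "Ybar_vec N Q Y = vec Q (\<lambda>q. Ybar N Y q)"

definition Scov :: "nat \<Rightarrow> (nat \<Rightarrow> nat \<Rightarrow> real) \<Rightarrow> nat \<Rightarrow> nat \<Rightarrow> real" where
  "Scov N Y q q' = (\<Sum>i<N. (Y i q - Ybar N Y q) * (Y i q' - Ybar N Y q')) / (real N - 1)"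

definition Yhat :: "nat \<Rightarrow> nat \<Rightarrow> (nat \<Rightarrow> nat) \<Rightarrow> (nat \<Rightarrow> nat \<Rightarrow> real) \<Rightarrow> (nat \<Rightarrow> nat) \<Rightarrow> real vec" where
  "Yhat N Q Nq Y Z = vec Q (\<lambda>q. (\<Sum>i\<in>{i \<in> {..<N}. Z i = q}. Y i q) / real (Nq q))"

definition Dmat :: "nat \<Rightarrow> nat \<Rightarrow> (nat \<Rightarrow> nat) \<Rightarrow> (nat \<Rightarrow> nat \<Rightarrow> real) \<Rightarrow> real mat" where
  "Dmat N Q Nq Y = mat Q Q (\<lambda>(q, q'). if q = q' then Scov N Y q q / real (Nq q) else 0)"

definition VY :: "nat \<Rightarrow> nat \<Rightarrow> (nat \<Rightarrow> nat) \<Rightarrow> (nat \<Rightarrow> nat \<Rightarrow> real) \<Rightarrow> real mat" where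
  "VY N Q Nq Y = Dmat N Q Nq Y - mat Q Q (\<lambda>(q, q'). Scov N Y q q' / real N)"

definition Vgamma :: "nat \<Rightarrow> nat \<Rightarrow> (nat \<Rightarrow> nat) \<Rightarrow> (nat \<Rightarrow> nat \<Rightarrow> real) \<Rightarrow> real mat \<Rightarrow> real mat" where
  "Vgamma N Q Nq Y F = transpose_mat F * VY N Q Nq Y * F"

definition pos_def_mat :: "nat \<Rightarrow> real mat \<Rightarrow> bool" where
  "pos_def_mat n A \<longleftrightarrow> (\<forall>x \<in> carrier_vec n. x \<noteq> 0\<^sub>v n \<longrightarrow> x \<bullet> (A *\<^sub>v x) > 0)"

definition inv_sqrt_mat :: "real mat \<Rightarrow> real mat" where
  "inv_sqrt_mat A = (THE W. W \<in> carrier_mat (dim_row A) (dim_row A) \<and> transpose_mat W = W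
      \<and> pos_def_mat (dim_row A) W \<and> W * W * A = 1\<^sub>m (dim_row A))"

definition loewner_le :: "nat \<Rightarrow> real mat \<Rightarrow> real mat \<Rightarrow> bool" where
  "loewner_le n A B \<longleftrightarrow> (\<forall>x \<in> carrier_vec n. x \<bullet> ((B - A) *\<^sub>v x) \<ge> 0)"

definition gamma_tilde :: "nat \<Rightarrow> nat \<Rightarrow> (nat \<Rightarrow> nat) \<Rightarrow> (nat \<Rightarrow> nat \<Rightarrow> real) \<Rightarrow> real mat
    \<Rightarrow> (nat \<Rightarrow> nat) \<Rightarrow> real vec" where
  "gamma_tilde N Q Nq Y F Z = inv_sqrt_mat (Vgamma N Q Nq Y F) *\<^sub>v
      (transpose_mat F *\<^sub>v Yhat N Q Nq Y Z - transpose_mat F *\<^sub>v Ybar_vec N Q Y)"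

definition MN :: "nat \<Rightarrow> (nat \<Rightarrow> nat \<Rightarrow> real) \<Rightarrow> nat \<Rightarrow> real" where
  "MN N Y q = Max ((\<lambda>i. \<bar>Y i q - Ybar N Y q\<bar>) ` {..<N})"

definition vec_sup_norm :: "real vec \<Rightarrow> real" where
  "vec_sup_norm x = Max ((\<lambda>k. \<bar>x $ k\<bar>) ` {..<dim_vec x})"

definition vec_norm2 :: "real vec \<Rightarrow> real" where
  "vec_norm2 x = sqrt (x \<bullet> x)"

definition rho_min :: "real mat \<Rightarrow> real" where
  "rho_min A = Min {k. eigenvalue A k}"

definition Phi :: "real \<Rightarrow> real" where
  "Phi t = measure (density lborel std_normal_density) {..t}"

end

theory Submission
  imports Defs "Jordan_Normal_Form.Schur_Decomposition"
begin

text \<open>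
  Put \<open>u = V\<^sub>\<gamma>\<^sup>-\<^sup>1\<^sup>/\<^sup>2 b\<close> and \<open>c = F u\<close>.  Then \<open>b \<bullet> \<gamma>~\<close> is the sum \<open>W\<close> over the units \<open>i\<close> of \<open>a i (Z i)\<close>
  with \<open>a i q = c\<^sub>q (Y i q - Ybar q) / N\<^sub>q\<close>.  Replacing \<open>Z\<close> by a level map composed with a uniformly
  random permutation \<open>\<pi>\<close> turns \<open>W\<close> into a combinatorial sum with mean 0 and variance 1, and both
  parts reduce to \<open>|P(W \<le> t) - \<Phi>(t)| \<le> C max |a i q|\<close>.

  This is the Berry-Esseen bound under a bounded zero-bias coupling (Goldstein).  Swapping two
  values of \<open>\<pi>\<close> gives an exchangeable pair with linear regression, so that \<open>E (W g(W))\<close> is an average of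
  \<open>(W'' - W') (g(W'') - g(W'))\<close> over \<open>i, j\<close> and the values \<open>p, q\<close> taken there.  A uniform permutation is made to
  satisfy \<open>\<pi> i = p\<close>, \<open>\<pi> j = q\<close> by two transpositions, which moves \<open>W\<close> by \<open>O(max |a|)\<close> only.  With \<open>g\<close> the
  solution of the Stein equation for \<open>{..z}\<close>, whose derivative is \<open>x g(x) + 1{x \<le> z} - \<Phi>(z)\<close>, the terms
  \<open>W g(W)\<close> cancel and the bound for indicators shifted by \<open>O(max |a|)\<close> remains.
\<close>

section \<open>The normal distribution function and the Stein equation\<close>

text \<open>The obstacle is the jump of g' at z, where g is the Stein solution: bounding its effect
  usually takes a concentration inequality for W. Here every point visited lies within a fixed
  \<epsilon> of W, so the indicator in g' is bounded by the one for W with threshold z + \<epsilon>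
  or z - \<epsilon>. Choosing z = t - \<epsilon> or z = t + \<epsilon> moves the threshold back to
  t, at the price of one Lipschitz step for \<open>Phi\<close>. No zero-bias variable is
  constructed. \<open>psum_stein_le\<close> is a one-sided inequality between sums over all
  permutations, with a function h in place of the derivative; lower bounds come from -g, and the
  variance from g(x) = x. The constant 12 * (mills 0 + 3) arises as follows. If |a| is at most
  \<delta>, forcing two values moves W by at most 8 \<delta> and the swap by 4 \<delta> more, so
  \<epsilon> = 12 \<delta>. Replacing x g(x) by W g(W) costs \<epsilon> (mills 0 + 2 |W|), where
  \<open>mills 0\<close> bounds g, 2 bounds its slope, and E |W| is at most 1. The Lipschitz step
  adds the last \<epsilon>.\<close>

lemma Phi_eq_cdf: "Phi = cdf std_normal_distribution"
  by (simp add: fun_eq_iff Phi_def cdf_def)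

lemma Phi_nonneg: "0 \<le> Phi x"
  by (simp add: Phi_def)

lemma Phi_le_1: "Phi x \<le> 1"
proof -
  interpret real_distribution std_normal_distribution by (rule real_dist_normal_dist)
  show ?thesis by (simp add: Phi_eq_cdf cdf_bounded_prob)
qed

lemma Phi_mono: "x \<le> y \<Longrightarrow> Phi x \<le> Phi y"
proof -
  interpret real_distribution std_normal_distribution by (rule real_dist_normal_dist)
  show "x \<le> y \<Longrightarrow> Phi x \<le> Phi y" by (simp add: Phi_eq_cdf cdf_nondecreasing)
qed

lemma Phi_at_top: "(Phi \<longlongrightarrow> 1) at_top"
proof -
  interpret real_distribution std_normal_distribution by (rule real_dist_normal_dist)
  show ?thesis by (simp add: Phi_eq_cdf cdf_lim_at_top_prob)
qed

lemma Phi_at_bot: "(Phi \<longlongrightarrow> 0) at_bot"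
proof -
  interpret real_distribution std_normal_distribution by (rule real_dist_normal_dist)
  show ?thesis by (simp add: Phi_eq_cdf cdf_lim_at_bot)
qed

lemma std_normal_density_pos: "0 < std_normal_density x"
  by (simp add: normal_density_def)

lemma std_normal_density_uminus: "std_normal_density (- x) = std_normal_density x"
  by (simp add: normal_density_def)

lemma std_normal_density_le_1: "std_normal_density x \<le> 1"
proof -
  have "1 \<le> sqrt (2 * pi)" using pi_ge_two by (intro real_le_rsqrt) auto
  moreover have "exp (- (x\<^sup>2 / 2)) \<le> 1" by simp
  ultimately have "exp (- (x\<^sup>2 / 2)) \<le> sqrt (2 * pi)" by linarith
  then show ?thesis by (simp add: std_normal_density_def divide_le_eq)
qed

lemma std_normal_density_deriv:
  "(std_normal_density has_real_derivative (- x * std_normal_density x)) (at x)"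
  unfolding std_normal_density_def
  by (auto intro!: derivative_eq_intros simp: field_simps)

lemma Phi_diff:
  assumes "a \<le> b"
  shows "Phi b - Phi a = integral {a..b} std_normal_density"
proof -
  interpret real_distribution std_normal_distribution by (rule real_dist_normal_dist)
  have eq: "{..b} - {..a} = {a<..b}" by auto
  have "Phi b - Phi a = measure std_normal_distribution {a<..b}"
    unfolding Phi_def using assms
    by (subst finite_measure_Diff[symmetric]) (auto simp: eq)
  also have "\<dots> = (LINT x:{a<..b}|lborel. std_normal_density x)"
  proof -
    have "measure std_normal_distribution {a<..b} = (LINT x|std_normal_distribution. indicator {a<..b} x)"
      by simp
    also have "\<dots> = (LINT x|lborel. std_normal_density x *\<^sub>R indicator {a<..b} x)"
      by (rule integral_density) auto
    finally show ?thesis by (simp add: set_lebesgue_integral_def mult.commute)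
  qed
  also have "\<dots> = integral {a<..b} std_normal_density"
    by (intro set_borel_integral_eq_integral, unfold set_integrable_def,
        intro integrable_mult_indicator) auto
  also have "\<dots> = integral {a..b} std_normal_density"
  proof (rule integral_subset_negligible)
    show "negligible ({a..b} - {a<..b})"
      by (rule negligible_subset[OF negligible_sing[of a]]) auto
  qed auto
  finally show ?thesis .
qed

lemma Phi_deriv: "(Phi has_real_derivative std_normal_density x) (at x)"
proof -
  have cont: "continuous_on {x-1..x+1} std_normal_density"
    unfolding std_normal_density_def by (intro continuous_intros) auto
  have "((\<lambda>u. integral {x-1..u} std_normal_density) has_real_derivative std_normal_density x)
          (at x within {x-1..x+1})"
    by (rule integral_has_real_derivative[OF cont]) auto
  then have "((\<lambda>u. integral {x-1..u} std_normal_density) has_real_derivative std_normal_density x) (at x)"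
    by (subst (asm) at_within_interior) auto
  then have "((\<lambda>u. Phi (x-1) + integral {x-1..u} std_normal_density) has_real_derivative
       0 + std_normal_density x) (at x)"
    by (intro DERIV_add) auto
  then show ?thesis
  proof (rule DERIV_cong_ev[THEN iffD1, rotated -1])
    have "eventually (\<lambda>u. u \<in> {x-1<..<x+1}) (nhds x)"
      by (intro eventually_nhds_in_open) auto
    then show "eventually (\<lambda>u. Phi (x - 1) + integral {x - 1..u} std_normal_density = Phi u) (nhds x)"
      by eventually_elim (auto simp flip: Phi_diff)
  qed auto
qed

text \<open>The density is even, so Phi (- x) + Phi x has derivative zero; its constant value is
  read off at infinity.\<close>

lemma Phi_uminus: "Phi (- x) = 1 - Phi x"
proof -
  define h where "h = (\<lambda>x. Phi (- x) + Phi x)"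
  have "(h has_real_derivative 0) (at y)" for y
    unfolding h_def
    by (auto intro!: derivative_eq_intros DERIV_chain2[OF Phi_deriv] Phi_deriv
        simp: std_normal_density_uminus)
  then have const: "h y = h x" for y by (metis DERIV_isconst_all)
  have "((\<lambda>y. Phi (- y)) \<longlongrightarrow> 0) at_top"
    by (rule filterlim_compose[OF Phi_at_bot filterlim_uminus_at_bot_at_top])
  then have "(h \<longlongrightarrow> 0 + 1) at_top"
    unfolding h_def by (intro tendsto_add Phi_at_top)
  moreover have "(h \<longlongrightarrow> h x) at_top" using const by (simp add: tendsto_eventually)
  ultimately have "h x = 0 + 1" by (intro tendsto_unique[of at_top]) auto
  then show ?thesis by (simp add: h_def)
qed

text \<open>The mean value theorem with the density bounded by 1; this is what a shift of the
  threshold will cost.\<close>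

lemma Phi_lipschitz: "a \<le> b \<Longrightarrow> Phi b - Phi a \<le> b - a"
proof (cases "a = b")
  case False
  assume "a \<le> b"
  with False have "a < b" by simp
  then obtain x where "Phi b - Phi a = (b - a) * std_normal_density x"
    using MVT2[of a b Phi std_normal_density] Phi_deriv by blast
  then show ?thesis using std_normal_density_le_1[of x] \<open>a < b\<close> by (simp add: mult_left_le)
qed auto

section \<open>The Mills ratio and the bounded solution of the Stein equation\<close>

definition mills :: "real \<Rightarrow> real" where
  "mills x = (1 - Phi x) / std_normal_density x"

lemma mills_nonneg: "0 \<le> mills x"
  using Phi_le_1[of x] std_normal_density_pos[of x] by (simp add: mills_def)

lemma mills_uminus: "mills (- x) = Phi x / std_normal_density x"
  by (simp add: mills_def Phi_uminus std_normal_density_uminus)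

text \<open>The Stein equation on one side of the threshold: multiples of \<open>mills x\<close>
  solve f' = x f - c, and multiples of \<open>mills (- x)\<close> solve f' = x f + c.\<close>

lemma mills_deriv: "(mills has_real_derivative (x * mills x - 1)) (at x)"
  unfolding mills_def using std_normal_density_pos[of x]
  by (auto intro!: derivative_eq_intros Phi_deriv std_normal_density_deriv
      simp: field_simps)

text \<open>Equivalent for x > 0 to the tail bound 1 - Phi x \<le> density / x. The gap between the
  two sides decreases on the positive axis and tends to 0, hence it is nonnegative.\<close>

lemma mills_upper:
  assumes "0 \<le> x"
  shows "x * mills x \<le> 1"
proof (cases "x = 0")
  case False
  with assms have "0 < x" by simp
  define h where "h = (\<lambda>x. std_normal_density x / x - (1 - Phi x))"
  have "h y \<le> h x" if "x \<le> y" for y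
  proof (rule DERIV_nonpos_imp_nonincreasing[OF that])
    fix u assume u: "x \<le> u" "u \<le> y"
    then have "u > 0" using \<open>0 < x\<close> by simp
    have "(h has_real_derivative - std_normal_density u / u\<^sup>2) (at u)"
      unfolding h_def using \<open>u > 0\<close>
      by (auto intro!: derivative_eq_intros Phi_deriv std_normal_density_deriv
          simp: field_simps power2_eq_square)
    moreover have "- std_normal_density u / u\<^sup>2 \<le> 0"
      using std_normal_density_pos[of u] by simp
    ultimately show "\<exists>D. (h has_real_derivative D) (at u) \<and> D \<le> 0" by blast
  qed
  then have ev: "eventually (\<lambda>y. h y \<le> h x) at_top"
    by (auto simp: eventually_at_top_linorder)
  have "((\<lambda>y. std_normal_density y / y) \<longlongrightarrow> 0) at_top"
  proof (rule tendsto_sandwich[of "\<lambda>_. 0" _ _ "\<lambda>y. 1 / y"])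
    show "eventually (\<lambda>y. 0 \<le> std_normal_density y / y) at_top"
      using eventually_gt_at_top[of 0] by eventually_elim auto
    show "eventually (\<lambda>y. std_normal_density y / y \<le> 1 / y) at_top"
      using eventually_gt_at_top[of 0]
      by eventually_elim (auto intro!: divide_right_mono std_normal_density_le_1)
    show "((\<lambda>y::real. 1 / y) \<longlongrightarrow> 0) at_top"
      by (intro tendsto_divide_0[OF tendsto_const] filterlim_at_top_imp_at_infinity filterlim_ident)
  qed auto
  then have "(h \<longlongrightarrow> 0 - (1 - 1)) at_top"
    unfolding h_def by (intro tendsto_diff Phi_at_top tendsto_const)
  then have "(h \<longlongrightarrow> 0) at_top" by simp
  from tendsto_upperbound[OF this ev] have "0 \<le> h x" by simp
  then have "1 - Phi x \<le> std_normal_density x / x" by (simp add: h_def)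
  then show ?thesis using \<open>0 < x\<close> std_normal_density_pos[of x]
    by (simp add: mills_def field_simps)
qed auto

text \<open>By \<open>mills_upper\<close> the derivative x * mills x - 1 is nonpositive on the
  positive half-line. The value \<open>mills 0\<close> is sqrt (pi / 2).\<close>

lemma mills_le_mills_0:
  assumes "0 \<le> x"
  shows "mills x \<le> mills 0"
  by (rule DERIV_nonpos_imp_nonincreasing[OF assms])
     (use mills_deriv mills_upper in \<open>auto intro!: exI\<close>)

text \<open>Both estimates reduce to the Mills ratio at |x|. For x \<le> 0 the factor 1 - Phi z is
  dropped; for 0 < x \<le> z, where \<open>mills (- x)\<close> is large, 1 - Phi z \<le> 1 - Phi x
  compensates and Phi x is dropped.\<close>

lemma mills_left_bounds:
  assumes "x \<le> z"
  shows "mills (- x) * (1 - Phi z) \<le> mills 0" "\<bar>x * (mills (- x) * (1 - Phi z))\<bar> \<le> 1"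
proof -
  have *: "0 \<le> 1 - Phi z" "1 - Phi z \<le> 1" using Phi_le_1 Phi_nonneg by auto
  have "mills (- x) * (1 - Phi z) \<le> mills 0 \<and> \<bar>x * (mills (- x) * (1 - Phi z))\<bar> \<le> 1"
  proof (cases "x \<le> 0")
    case True
    have le: "mills (- x) * (1 - Phi z) \<le> mills (- x)"
      using * mills_nonneg[of "- x"] by (simp add: mult_left_le)
    moreover have "mills (- x) \<le> mills 0" using True by (intro mills_le_mills_0) auto
    moreover have "\<bar>x * (mills (- x) * (1 - Phi z))\<bar> = (- x) * (mills (- x) * (1 - Phi z))"
      using True * mills_nonneg[of "- x"] by (simp add: abs_mult)
    moreover have "\<dots> \<le> (- x) * mills (- x)"
      by (rule mult_left_mono[OF le]) (use True in auto)
    moreover have "\<dots> \<le> 1" using True by (intro mills_upper) auto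
    ultimately show ?thesis by linarith
  next
    case False
    have "mills (- x) * (1 - Phi z) = Phi x * (1 - Phi z) / std_normal_density x"
      by (simp add: mills_uminus)
    also have "\<dots> \<le> 1 * (1 - Phi x) / std_normal_density x"
      using Phi_mono[OF assms] * Phi_le_1[of x] Phi_nonneg[of x] std_normal_density_pos[of x]
      by (intro divide_right_mono mult_mono) auto
    also have "\<dots> = mills x" by (simp add: mills_def)
    finally have le: "mills (- x) * (1 - Phi z) \<le> mills x" .
    moreover have "mills x \<le> mills 0" using False by (intro mills_le_mills_0) auto
    moreover have "\<bar>x * (mills (- x) * (1 - Phi z))\<bar> = x * (mills (- x) * (1 - Phi z))"
      using False * mills_nonneg[of "- x"] by (simp add: abs_mult)
    moreover have "\<dots> \<le> x * mills x"
      by (rule mult_left_mono[OF le]) (use False in auto)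
    moreover have "\<dots> \<le> 1" using False by (intro mills_upper) auto
    ultimately show ?thesis by linarith
  qed
  then show "mills (- x) * (1 - Phi z) \<le> mills 0" "\<bar>x * (mills (- x) * (1 - Phi z))\<bar> \<le> 1"
    by auto
qed

text \<open>The bounded solution of g'(x) - x g(x) = 1{x \<le> z} - Phi z; the others differ from it
  by multiples of exp (x^2 / 2). The left branch integrates the right-hand side against the density
  from minus infinity to x, the right branch is minus the integral from x to infinity, each divided
  by the density at x.\<close>

definition stein :: "real \<Rightarrow> real \<Rightarrow> real" where
  "stein z x = (if x \<le> z then mills (- x) * (1 - Phi z) else mills x * Phi z)"

lemma stein_right: "z \<le> x \<Longrightarrow> stein z x = mills x * Phi z"
  by (auto simp: stein_def mills_uminus) (simp add: mills_def)

text \<open>Reflection exchanges the two branches, so bounds for x \<le> z also settle x > z. At x =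
  z it rests on the agreement of the branches, which is \<open>stein_right\<close>.\<close>

lemma stein_reflect: "stein z x = stein (- z) (- x)"
  using stein_right[of "- z" "- x"] stein_right[of z x]
  by (auto simp: stein_def Phi_uminus)

lemma stein_bounds: "0 \<le> stein z x" "stein z x \<le> mills 0" "\<bar>x * stein z x\<bar> \<le> 1"
proof -
  show "0 \<le> stein z x"
    using mills_nonneg Phi_nonneg[of z] Phi_le_1[of z] by (simp add: stein_def)
  have "stein z x \<le> mills 0 \<and> \<bar>x * stein z x\<bar> \<le> 1"
  proof (cases "x \<le> z")
    case True
    then show ?thesis using mills_left_bounds[OF True] by (simp add: stein_def)
  next
    case False
    then have "- x \<le> - z" by simp
    from mills_left_bounds[OF this] have "stein (- z) (- x) \<le> mills 0 \<and> \<bar>(- x) * stein (- z) (- x)\<bar> \<le> 1"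
      using False by (simp add: stein_def)
    then show ?thesis by (simp flip: stein_reflect)
  qed
  then show "stein z x \<le> mills 0" "\<bar>x * stein z x\<bar> \<le> 1" by auto
qed

lemma stein_deriv_left:
  assumes "x < z"
  shows "(stein z has_real_derivative (x * stein z x + (1 - Phi z))) (at x)"
proof -
  have "((\<lambda>x. mills (- x) * (1 - Phi z)) has_real_derivative (x * stein z x + (1 - Phi z))) (at x)"
    using assms by (auto intro!: derivative_eq_intros DERIV_chain2[OF mills_deriv]
        simp: stein_def algebra_simps)
  then show ?thesis
  proof (rule DERIV_cong_ev[THEN iffD1, rotated -1])
    have "eventually (\<lambda>u. u \<in> {..<z}) (nhds x)"
      using assms by (intro eventually_nhds_in_open) auto
    then show "eventually (\<lambda>u. mills (- u) * (1 - Phi z) = stein z u) (nhds x)"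
      by eventually_elim (auto simp: stein_def)
  qed auto
qed

lemma stein_deriv_right:
  assumes "z < x"
  shows "(stein z has_real_derivative (x * stein z x - Phi z)) (at x)"
proof -
  have "((\<lambda>x. mills x * Phi z) has_real_derivative (x * stein z x - Phi z)) (at x)"
    using assms by (auto intro!: derivative_eq_intros mills_deriv
        simp: stein_def algebra_simps)
  then show ?thesis
  proof (rule DERIV_cong_ev[THEN iffD1, rotated -1])
    have "eventually (\<lambda>u. u \<in> {z<..}) (nhds x)"
      using assms by (intro eventually_nhds_in_open) auto
    then show "eventually (\<lambda>u. mills u * Phi z = stein z u) (nhds x)"
      by eventually_elim (auto simp: stein_def)
  qed auto
qed

lemma isCont_mills: "isCont mills x"
  using mills_deriv DERIV_isCont by blast

lemma continuous_on_stein: "continuous_on A (stein z)"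
proof -
  have m: "continuous_on B mills" for B
    using isCont_mills by (simp add: continuous_at_imp_continuous_on)
  have "continuous_on ({..z} \<union> {z..}) (stein z)"
  proof (rule continuous_on_closed_Un)
    show "continuous_on {..z} (stein z)"
      by (subst continuous_on_cong[OF refl, of _ _ "\<lambda>x. mills (- x) * (1 - Phi z)"])
         (auto simp: stein_def intro!: continuous_intros continuous_on_compose2[OF m[of UNIV]])
    show "continuous_on {z..} (stein z)"
      by (subst continuous_on_cong[OF refl, of _ _ "\<lambda>x. mills x * Phi z"])
         (auto simp: stein_right intro!: continuous_intros m)
  qed auto
  moreover have "{..z} \<union> {z..} = UNIV" by auto
  ultimately show ?thesis using continuous_on_subset by fastforce
qed

section \<open>Increments of the Stein solution\<close>

lemma increment_le_of_deriv_le: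
  fixes f f' :: "real \<Rightarrow> real"
  assumes "a \<le> b" "continuous_on {a..b} f"
    and "\<And>x. a < x \<Longrightarrow> x < b \<Longrightarrow> x \<noteq> z \<Longrightarrow> (f has_real_derivative f' x) (at x)"
    and "\<And>x. a < x \<Longrightarrow> x < b \<Longrightarrow> x \<noteq> z \<Longrightarrow> f' x \<le> M"
  shows "f b - f a \<le> M * (b - a)"
proof -
  \<comment> \<open>The mean value theorem asks for differentiability only in the interior, so z may
    be an endpoint; an interval containing z is cut there.\<close>
  have aux: "f v - f u \<le> M * (v - u)" if "a \<le> u" "u \<le> v" "v \<le> b" "z \<notin> {u<..<v}" for u v
  proof (cases "u = v")
    case False
    with that have uv: "u < v" by simp
    have d: "(f has_real_derivative f' x) (at x)" if "u < x" "x < v" for x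
      using assms(3)[of x] that \<open>a \<le> u\<close> \<open>v \<le> b\<close> \<open>z \<notin> _\<close> by auto
    have "\<exists>l x. u < x \<and> x < v \<and> (f has_real_derivative l) (at x) \<and> f v - f u = (v - u) * l"
    proof (rule MVT[OF uv])
      show "continuous_on {u..v} f" using assms(2) by (rule continuous_on_subset) (use that in auto)
      show "f differentiable (at x)" if "u < x" "x < v" for x
        using d[OF that] real_differentiable_def by blast
    qed
    then obtain l x where lx: "u < x" "x < v" "(f has_real_derivative l) (at x)"
      "f v - f u = (v - u) * l" by blast
    have "l = f' x" using lx(3) d[OF lx(1,2)] by (rule DERIV_unique)
    also have "\<dots> \<le> M" using assms(4)[of x] lx that by auto
    finally show ?thesis using lx(4) uv by (simp add: mult.commute)
  qed auto
  show ?thesis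
  proof (cases "a \<le> z \<and> z \<le> b")
    case True
    then have "f z - f a \<le> M * (z - a)" "f b - f z \<le> M * (b - z)" by (auto intro!: aux)
    then show ?thesis by (simp add: algebra_simps)
  next
    case False
    then show ?thesis using assms(1) by (intro aux) auto
  qed
qed

text \<open>By the Stein equation |g'(x)| is at most |x g(x)| plus a probability, hence at most 2
  away from the corner at z.\<close>

lemma stein_lipschitz: "\<bar>stein z x - stein z y\<bar> \<le> 2 * \<bar>x - y\<bar>"
proof -
  have main: "\<bar>stein z b - stein z a\<bar> \<le> 2 * (b - a)" if "a \<le> b" for a b
  proof -
    define f' where "f' = (\<lambda>x. x * stein z x + (if x < z then 1 - Phi z else - Phi z))"
    have d: "(stein z has_real_derivative f' x) (at x)" if "x \<noteq> z" for x
      using that stein_deriv_left[of x z] stein_deriv_right[of z x] by (auto simp: f'_def)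
    have f': "\<bar>f' x\<bar> \<le> 2" for x
      using stein_bounds(3)[of x z] Phi_nonneg[of z] Phi_le_1[of z] by (auto simp: f'_def)
    have "stein z b - stein z a \<le> 2 * (b - a)"
      by (rule increment_le_of_deriv_le[where f' = f' and z = z])
         (use that d f' in \<open>auto intro: continuous_on_stein simp: abs_le_iff\<close>)
    moreover have "(- stein z b) - (- stein z a) \<le> 2 * (b - a)"
      by (rule increment_le_of_deriv_le[where f = "\<lambda>x. - stein z x" and f' = "\<lambda>x. - f' x" and z = z])
         (use that d f' in \<open>auto intro!: continuous_intros continuous_on_stein derivative_intros simp: abs_le_iff\<close>)
    ultimately show ?thesis by linarith
  qed
  show ?thesis using main[of x y] main[of y x] by (cases "x \<le> y") auto
qed

text \<open>The linear growth of the error in |w| is harmless, since only the mean of |W| will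
  enter.\<close>

lemma times_stein_diff:
  assumes "\<bar>x - w\<bar> \<le> \<epsilon>"
  shows "\<bar>x * stein z x - w * stein z w\<bar> \<le> \<epsilon> * (mills 0 + 2 * \<bar>w\<bar>)"
proof -
  have "x * stein z x - w * stein z w = (x - w) * stein z x + w * (stein z x - stein z w)"
    by (simp add: algebra_simps)
  then have "\<bar>x * stein z x - w * stein z w\<bar> \<le> \<bar>x - w\<bar> * \<bar>stein z x\<bar> + \<bar>w\<bar> * \<bar>stein z x - stein z w\<bar>"
    by (metis abs_mult abs_triangle_ineq)
  also have "\<dots> \<le> \<epsilon> * mills 0 + \<bar>w\<bar> * (2 * \<epsilon>)"
    using stein_bounds[of z x] stein_lipschitz[of z x w] assms
    by (intro add_mono mult_mono) auto
  finally show ?thesis by (simp add: algebra_simps)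
qed

text \<open>Each x between a and b is within \<epsilon> of w. So in g'(x) the term x g(x) differs
  from w g(w) by at most the error of \<open>times_stein_diff\<close>, and x < z forces w \<le> z +
  \<epsilon>. Multiplying the increment by b - a makes the claim symmetric in a and b.\<close>

lemma stein_increment_upper:
  assumes "\<bar>a - w\<bar> \<le> \<epsilon>" "\<bar>b - w\<bar> \<le> \<epsilon>"
  shows "(b - a) * (stein z b - stein z a) \<le> (b - a)\<^sup>2 *
    (w * stein z w + \<epsilon> * (mills 0 + 2 * \<bar>w\<bar>) + of_bool (w \<le> z + \<epsilon>) - Phi z)"
proof -
  let ?M = "w * stein z w + \<epsilon> * (mills 0 + 2 * \<bar>w\<bar>) + of_bool (w \<le> z + \<epsilon>) - Phi z"
  have main: "stein z b - stein z a \<le> ?M * (b - a)"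
    if "a \<le> b" "\<bar>a - w\<bar> \<le> \<epsilon>" "\<bar>b - w\<bar> \<le> \<epsilon>" for a b
  proof (rule increment_le_of_deriv_le[where z = z and
        f' = "\<lambda>x. x * stein z x + (if x < z then 1 - Phi z else - Phi z)"])
    fix x assume x: "a < x" "x < b" "x \<noteq> z"
    then have "\<bar>x - w\<bar> \<le> \<epsilon>" using that by auto
    from times_stein_diff[OF this, of z] x that
    show "x * stein z x + (if x < z then 1 - Phi z else - Phi z) \<le> ?M"
      by (auto simp: abs_le_iff)
  qed (use that stein_deriv_left stein_deriv_right in \<open>auto intro: continuous_on_stein\<close>)
  show ?thesis
  proof (cases "a \<le> b")
    case True
    from mult_left_mono[OF main[OF True assms], of "b - a"] True show ?thesis
      by (simp add: power2_eq_square mult_ac)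
  next
    case False
    then have "b \<le> a" by simp
    from mult_left_mono[OF main[OF this assms(2,1)], of "a - b"] False
    have "(a - b) * (stein z a - stein z b) \<le> (a - b)\<^sup>2 * ?M"
      by (simp add: power2_eq_square mult_ac)
    moreover have "(a - b) * (stein z a - stein z b) = (b - a) * (stein z b - stein z a)"
      by (simp add: algebra_simps)
    ultimately show ?thesis by (simp add: power2_commute)
  qed
qed

text \<open>The mirror image of \<open>stein_increment_upper\<close>: away from the corner, w \<le>
  z - \<epsilon> forces x < z.\<close>

lemma stein_increment_lower:
  assumes "\<bar>a - w\<bar> \<le> \<epsilon>" "\<bar>b - w\<bar> \<le> \<epsilon>"
  shows "(b - a)\<^sup>2 *
    (w * stein z w - \<epsilon> * (mills 0 + 2 * \<bar>w\<bar>) + of_bool (w \<le> z - \<epsilon>) - Phi z)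
    \<le> (b - a) * (stein z b - stein z a)"
proof -
  let ?M = "w * stein z w - \<epsilon> * (mills 0 + 2 * \<bar>w\<bar>) + of_bool (w \<le> z - \<epsilon>) - Phi z"
  have main: "(- stein z b) - (- stein z a) \<le> (- ?M) * (b - a)"
    if "a \<le> b" "\<bar>a - w\<bar> \<le> \<epsilon>" "\<bar>b - w\<bar> \<le> \<epsilon>" for a b
  proof (rule increment_le_of_deriv_le[where z = z and f = "\<lambda>x. - stein z x" and
        f' = "\<lambda>x. - (x * stein z x + (if x < z then 1 - Phi z else - Phi z))"])
    fix x assume x: "a < x" "x < b" "x \<noteq> z"
    then have "\<bar>x - w\<bar> \<le> \<epsilon>" using that by auto
    from times_stein_diff[OF this, of z] x that
    show "- (x * stein z x + (if x < z then 1 - Phi z else - Phi z)) \<le> - ?M"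
      by (auto simp: abs_le_iff)
    show "((\<lambda>x. - stein z x) has_real_derivative
        - (x * stein z x + (if x < z then 1 - Phi z else - Phi z))) (at x)"
      using x stein_deriv_left[of x z] stein_deriv_right[of z x]
      by (intro DERIV_minus) auto
  qed (use that in \<open>auto intro!: continuous_intros continuous_on_stein\<close>)
  show ?thesis
  proof (cases "a \<le> b")
    case True
    from mult_left_mono[OF main[OF True assms], of "b - a"] True
    show ?thesis by (simp add: power2_eq_square algebra_simps)
  next
    case False
    then have "b \<le> a" by simp
    from mult_left_mono[OF main[OF this assms(2,1)], of "a - b"] False
    show ?thesis by (simp add: power2_eq_square algebra_simps)
  qed
qed

section \<open>Sums along a uniformly random permutation\<close>

abbreviation perms :: "nat \<Rightarrow> (nat \<Rightarrow> nat) set" where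
  "perms n \<equiv> {\<pi>. \<pi> permutes {..<n}}"

abbreviation tswap :: "nat \<Rightarrow> nat \<Rightarrow> nat \<Rightarrow> nat" where
  "tswap \<equiv> Transposition.transpose"

definition psum :: "nat \<Rightarrow> (nat \<Rightarrow> nat \<Rightarrow> real) \<Rightarrow> (nat \<Rightarrow> nat) \<Rightarrow> real" where
  "psum n a \<pi> = (\<Sum>i<n. a i (\<pi> i))"

definition swap_diff :: "(nat \<Rightarrow> nat \<Rightarrow> real) \<Rightarrow> nat \<Rightarrow> nat \<Rightarrow> nat \<Rightarrow> nat \<Rightarrow> real" where
  "swap_diff a i j p q = a i q + a j p - a i p - a j q"

lemma swap_diff_same [simp]: "swap_diff a i i p q = 0" "swap_diff a i j p p = 0"
  by (simp_all add: swap_diff_def)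

lemma abs_swap_diff_le:
  assumes "\<And>i j. i < n \<Longrightarrow> j < n \<Longrightarrow> \<bar>a i j\<bar> \<le> \<delta>" "i < n" "j < n" "p < n" "q < n"
  shows "\<bar>swap_diff a i j p q\<bar> \<le> 4 * \<delta>"
  using assms(1)[of i q] assms(1)[of j p] assms(1)[of i p] assms(1)[of j q] assms(2-)
  unfolding swap_diff_def by linarith

lemma finite_perms [simp]: "finite (perms n)"
  by (rule finite_permutations) simp

lemma card_perms: "card (perms n) = fact n"
  by (rule card_permutations) auto

lemma psum_comp_transpose:
  assumes "i < n" "j < n"
  shows "psum n a (\<pi> \<circ> tswap i j) = psum n a \<pi> + swap_diff a i j (\<pi> i) (\<pi> j)"
proof (cases "i = j")
  case False
  have fin: "finite ({..<n} - {i, j})" by simp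
  have split: "(\<Sum>k<n. f k) = f i + f j + (\<Sum>k\<in>{..<n} - {i, j}. f k)" for f :: "nat \<Rightarrow> real"
  proof -
    have "(\<Sum>k<n. f k) = (\<Sum>k\<in>insert i (insert j ({..<n} - {i, j})). f k)"
      by (rule sum.cong) (use assms in auto)
    then show ?thesis using False by (simp add: sum.insert[OF fin])
  qed
  have "(\<Sum>k\<in>{..<n} - {i, j}. a k ((\<pi> \<circ> tswap i j) k)) = (\<Sum>k\<in>{..<n} - {i, j}. a k (\<pi> k))"
    by (rule sum.cong) (auto simp: Transposition.transpose_def)
  then show ?thesis using False
    by (simp add: psum_def split swap_diff_def)
qed auto

text \<open>Post-composing with \<open>tswap (\<pi> i) p\<close> forces \<open>\<pi> i = p\<close> and maps the uniform distribution
  to the conditional one.\<close>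

lemma sum_force_value:
  fixes G :: "(nat \<Rightarrow> nat) \<Rightarrow> real"
  assumes "finite S" "finite R" "p \<in> R"
    and val: "\<And>\<pi>. \<pi> \<in> S \<Longrightarrow> \<pi> i \<in> R"
    and closed: "\<And>r \<pi>. r \<in> R \<Longrightarrow> \<pi> \<in> S \<Longrightarrow> tswap r p \<circ> \<pi> \<in> S"
  shows "(\<Sum>\<pi>\<in>S. G (tswap (\<pi> i) p \<circ> \<pi>)) = real (card R) * (\<Sum>\<pi> | \<pi> \<in> S \<and> \<pi> i = p. G \<pi>)"
proof -
  have "(\<Sum>\<pi>\<in>S. G (tswap (\<pi> i) p \<circ> \<pi>))
      = (\<Sum>r\<in>R. \<Sum>\<pi> | \<pi> \<in> S \<and> \<pi> i = r. G (tswap (\<pi> i) p \<circ> \<pi>))"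
    by (rule sum.group[symmetric]) (use assms in auto)
  also have "\<dots> = (\<Sum>r\<in>R. \<Sum>\<pi> | \<pi> \<in> S \<and> \<pi> i = p. G \<pi>)"
  proof (rule sum.cong[OF refl])
    fix r assume r: "r \<in> R"
    show "(\<Sum>\<pi> | \<pi> \<in> S \<and> \<pi> i = r. G (tswap (\<pi> i) p \<circ> \<pi>)) = (\<Sum>\<pi> | \<pi> \<in> S \<and> \<pi> i = p. G \<pi>)"
      by (rule sum.reindex_bij_witness[where i = "\<lambda>\<pi>. tswap r p \<circ> \<pi>" and j = "\<lambda>\<pi>. tswap r p \<circ> \<pi>"])
         (use closed[OF r] in \<open>auto simp: fun_eq_iff\<close>)
  qed
  finally show ?thesis by simp
qed

lemma transpose_comp_in_perms:
  "\<pi> \<in> perms n \<Longrightarrow> r < n \<Longrightarrow> p < n \<Longrightarrow> tswap r p \<circ> \<pi> \<in> perms n"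
  by (auto intro!: permutes_compose permutes_swap_id)

lemma comp_transpose_in_perms:
  "\<pi> \<in> perms n \<Longrightarrow> r < n \<Longrightarrow> p < n \<Longrightarrow> \<pi> \<circ> tswap r p \<in> perms n"
  by (auto intro!: permutes_compose permutes_swap_id)

lemma perms_less: "\<pi> \<in> perms n \<Longrightarrow> i < n \<Longrightarrow> \<pi> i < n"
  using permutes_in_image[of \<pi> "{..<n}" i] by auto

lemma perms_inj: "\<pi> \<in> perms n \<Longrightarrow> \<pi> i = \<pi> j \<longleftrightarrow> i = j"
  using permutes_inj[of \<pi> "{..<n}"] by (auto dest: injD)

text \<open>The first transposition puts p at i. The second moves only the values
  \<open>\<rho> j\<close> and q; for i \<noteq> j and p \<noteq> q neither of them is p, so the
  value at i survives.\<close>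

definition force2 :: "nat \<Rightarrow> nat \<Rightarrow> nat \<Rightarrow> nat \<Rightarrow> (nat \<Rightarrow> nat) \<Rightarrow> nat \<Rightarrow> nat" where
  "force2 i j p q \<pi> = (let \<rho> = tswap (\<pi> i) p \<circ> \<pi> in tswap (\<rho> j) q \<circ> \<rho>)"

lemma sum_force2:
  fixes G :: "(nat \<Rightarrow> nat) \<Rightarrow> real"
  assumes "i < n" "j < n" "i \<noteq> j" "p < n" "q < n" "p \<noteq> q"
  shows "(\<Sum>\<pi>\<in>perms n. G (force2 i j p q \<pi>))
     = real n * (real n - 1) * (\<Sum>\<pi> | \<pi> \<in> perms n \<and> \<pi> i = p \<and> \<pi> j = q. G \<pi>)"
proof -
  have "(\<Sum>\<pi>\<in>perms n. G (force2 i j p q \<pi>))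
      = real (card {..<n}) * (\<Sum>\<pi> | \<pi> \<in> perms n \<and> \<pi> i = p. G (tswap (\<pi> j) q \<circ> \<pi>))"
    unfolding force2_def Let_def
    by (rule sum_force_value[where G = "\<lambda>\<rho>. G (tswap (\<rho> j) q \<circ> \<rho>)" and S = "perms n"])
       (use assms perms_less transpose_comp_in_perms in auto)
  \<comment> \<open>Once p is taken, the value at j ranges over the other n - 1 points; this gives
    the second factor.\<close>
  also have "(\<Sum>\<pi> | \<pi> \<in> perms n \<and> \<pi> i = p. G (tswap (\<pi> j) q \<circ> \<pi>))
      = real (card ({..<n} - {p})) * (\<Sum>\<pi> | \<pi> \<in> {\<pi>. \<pi> \<in> perms n \<and> \<pi> i = p} \<and> \<pi> j = q. G \<pi>)"
  proof (rule sum_force_value[where S = "{\<pi>. \<pi> \<in> perms n \<and> \<pi> i = p}"])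
    show "finite {\<pi>. \<pi> \<in> perms n \<and> \<pi> i = p}"
      by (rule finite_subset[OF _ finite_perms[of n]]) auto
    show "\<pi> j \<in> {..<n} - {p}" if "\<pi> \<in> {\<pi>. \<pi> \<in> perms n \<and> \<pi> i = p}" for \<pi>
      using that assms perms_less[of \<pi> n j] perms_inj[of \<pi> n i j] by auto
    show "tswap r q \<circ> \<pi> \<in> {\<pi>. \<pi> \<in> perms n \<and> \<pi> i = p}"
      if "r \<in> {..<n} - {p}" "\<pi> \<in> {\<pi>. \<pi> \<in> perms n \<and> \<pi> i = p}" for r \<pi>
      using that assms transpose_comp_in_perms[of \<pi> n r q] by (auto simp: Transposition.transpose_def)
  qed (use assms in auto)
  also have "{\<pi>. \<pi> \<in> {\<pi>. \<pi> \<in> perms n \<and> \<pi> i = p} \<and> \<pi> j = q} = {\<pi>. \<pi> \<in> perms n \<and> \<pi> i = p \<and> \<pi> j = q}"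
    by auto
  also have "real (card ({..<n} - {p})) = real n - 1"
    using assms by (simp add: of_nat_diff)
  finally show ?thesis by (simp add: mult_ac)
qed

text \<open>Swapping the values \<open>\<pi> i\<close> and p amounts to swapping the positions i and
  k with \<open>\<pi> k = p\<close>. Only two summands change, hence the four terms of
  \<open>swap_diff\<close>.\<close>

lemma abs_psum_transpose_comp:
  assumes bd: "\<And>i j. i < n \<Longrightarrow> j < n \<Longrightarrow> \<bar>a i j\<bar> \<le> \<delta>"
    and "\<pi> \<in> perms n" "i < n" "p < n"
  shows "\<bar>psum n a (tswap (\<pi> i) p \<circ> \<pi>) - psum n a \<pi>\<bar> \<le> 4 * \<delta>"
proof -
  obtain k where k: "k < n" "\<pi> k = p"
    using assms(2,4) permutes_image[of \<pi> "{..<n}"] by (metis image_iff lessThan_iff mem_Collect_eq)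
  have "tswap (\<pi> i) p \<circ> \<pi> = \<pi> \<circ> tswap i k"
    using k perms_inj[OF assms(2)] by (auto simp: fun_eq_iff Transposition.transpose_def)
  then have "psum n a (tswap (\<pi> i) p \<circ> \<pi>) - psum n a \<pi> = swap_diff a i k (\<pi> i) (\<pi> k)"
    using psum_comp_transpose[OF assms(3) k(1), of a \<pi>] by simp
  then show ?thesis
    using abs_swap_diff_le[OF bd assms(3) k(1) perms_less[OF assms(2,3)] perms_less[OF assms(2) k(1)]]
    by simp
qed

lemma force2_in:
  assumes "\<pi> \<in> perms n" "i < n" "j < n" "i \<noteq> j" "p < n" "q < n" "p \<noteq> q"
  shows "force2 i j p q \<pi> \<in> perms n" "force2 i j p q \<pi> i = p" "force2 i j p q \<pi> j = q"
proof -
  let ?\<rho> = "tswap (\<pi> i) p \<circ> \<pi>"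
  have \<rho>: "?\<rho> \<in> perms n" using assms perms_less by (intro transpose_comp_in_perms) auto
  show "force2 i j p q \<pi> \<in> perms n"
    unfolding force2_def Let_def
    by (rule transpose_comp_in_perms[OF \<rho> perms_less[OF \<rho>]]) (use assms in auto)
  have "?\<rho> i = p" by simp
  moreover have "?\<rho> j \<noteq> p" using perms_inj[OF \<rho>, of i j] assms(4) by simp
  ultimately show "force2 i j p q \<pi> i = p" "force2 i j p q \<pi> j = q"
    unfolding force2_def Let_def using assms(7) by (auto simp: Transposition.transpose_def)
qed

lemma abs_psum_force2:
  assumes bd: "\<And>i j. i < n \<Longrightarrow> j < n \<Longrightarrow> \<bar>a i j\<bar> \<le> \<delta>"
    and "\<pi> \<in> perms n" "i < n" "j < n" "p < n" "q < n"
  shows "\<bar>psum n a (force2 i j p q \<pi>) - psum n a \<pi>\<bar> \<le> 8 * \<delta>"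
proof -
  let ?\<rho> = "tswap (\<pi> i) p \<circ> \<pi>"
  have \<rho>: "?\<rho> \<in> perms n" using assms perms_less by (intro transpose_comp_in_perms) auto
  have "\<bar>psum n a (force2 i j p q \<pi>) - psum n a ?\<rho>\<bar> \<le> 4 * \<delta>"
    unfolding force2_def Let_def by (rule abs_psum_transpose_comp[OF bd \<rho>]) (use assms in auto)
  moreover have "\<bar>psum n a ?\<rho> - psum n a \<pi>\<bar> \<le> 4 * \<delta>"
    by (rule abs_psum_transpose_comp[OF bd]) (use assms in auto)
  ultimately show ?thesis by linarith
qed

text \<open>The pair \<open>(\<pi>, \<pi> \<circ> tswap i j)\<close> is exchangeable, and averaging the increments over \<open>i\<close> and \<open>j\<close>
  gives the linear regression \<open>- 2 n W\<close>.\<close>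

lemma sum_swap_diff:
  assumes "(\<Sum>i<n. \<Sum>j<n. a i j) = 0" "\<pi> \<in> perms n"
  shows "(\<Sum>i<n. \<Sum>j<n. swap_diff a i j (\<pi> i) (\<pi> j)) = - 2 * real n * psum n a \<pi>"
proof -
  have perm: "(\<Sum>j<n. f (\<pi> j)) = (\<Sum>j<n. f j)" for f :: "nat \<Rightarrow> real"
    using assms(2) sum.permute[of \<pi> "{..<n}" f] by (simp add: comp_def)
  have 1: "(\<Sum>i<n. \<Sum>j<n. a i (\<pi> j)) = 0" using assms(1) by (simp add: perm)
  have 2: "(\<Sum>i<n. \<Sum>j<n. a j (\<pi> i)) = 0" using 1 by (subst sum.swap) simp
  show ?thesis
    unfolding swap_diff_def psum_def
    by (simp add: sum.distrib sum_subtractf 1 2 sum_distrib_left mult.assoc)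
qed

text \<open>Composition with \<open>tswap i j\<close> is an involution that reverses the sign of
  \<open>swap_diff\<close>, so the two terms of the difference contribute equally.\<close>

lemma sum_exchangeable:
  assumes "i < n" "j < n"
  shows "(\<Sum>\<pi>\<in>perms n. swap_diff a i j (\<pi> i) (\<pi> j) * (g (psum n a (\<pi> \<circ> tswap i j)) - g (psum n a \<pi>)))
     = - 2 * (\<Sum>\<pi>\<in>perms n. swap_diff a i j (\<pi> i) (\<pi> j) * g (psum n a \<pi>))"
proof -
  have "(\<Sum>\<pi>\<in>perms n. swap_diff a i j (\<pi> i) (\<pi> j) * g (psum n a (\<pi> \<circ> tswap i j)))
      = (\<Sum>\<pi>\<in>perms n. - (swap_diff a i j (\<pi> i) (\<pi> j) * g (psum n a \<pi>)))"
    by (rule sum.reindex_bij_witness[where i = "\<lambda>\<pi>. \<pi> \<circ> tswap i j" and j = "\<lambda>\<pi>. \<pi> \<circ> tswap i j"])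
       (use assms comp_transpose_in_perms[of _ n i j] in
          \<open>auto simp: fun_eq_iff swap_diff_def algebra_simps\<close>)
  then show ?thesis by (simp add: right_diff_distrib sum_subtractf sum_negf)
qed

section \<open>A Stein inequality for sums along a random permutation\<close>

definition swap_var :: "nat \<Rightarrow> (nat \<Rightarrow> nat \<Rightarrow> real) \<Rightarrow> real" where
  "swap_var n a = (\<Sum>i<n. \<Sum>j<n. \<Sum>p<n. \<Sum>q<n. (swap_diff a i j p q)\<^sup>2) / (4 * (real n)\<^sup>2 * (real n - 1))"

text \<open>On the cell \<pi> i = p, \<pi> j = q the swap changes the sum by the constant
  \<open>swap_diff a i j p q\<close>. Through \<open>force2\<close> an average over the cell becomes
  an average over all \<pi>, and h is evaluated at the unforced W, whose distribution does not
  depend on the cell. Therefore the squared increments factor out and add up to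
  \<open>swap_var\<close>.\<close>

lemma psum_stein_le:
  fixes g h :: "real \<Rightarrow> real"
  assumes n: "2 \<le> n" and tot: "(\<Sum>i<n. \<Sum>j<n. a i j) = 0"
    and bd: "\<And>i j. i < n \<Longrightarrow> j < n \<Longrightarrow> \<bar>a i j\<bar> \<le> \<delta>"
    and gh: "\<And>w x y. \<bar>x - w\<bar> \<le> 12 * \<delta> \<Longrightarrow> \<bar>y - w\<bar> \<le> 12 * \<delta> \<Longrightarrow> (y - x) * (g y - g x) \<le> (y - x)\<^sup>2 * h w"
  shows "(\<Sum>\<pi>\<in>perms n. psum n a \<pi> * g (psum n a \<pi>)) \<le> swap_var n a * (\<Sum>\<pi>\<in>perms n. h (psum n a \<pi>))"
proof -
  define W where "W = psum n a"
  define D where "D = (\<lambda>i j \<pi>. swap_diff a i j (\<pi> i) (\<pi> j) :: real)"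
  define X where "X = (\<lambda>i j \<pi>. D i j \<pi> * (g (W (\<pi> \<circ> tswap i j)) - g (W \<pi>)))"
  define T where "T = (\<Sum>\<pi>\<in>perms n. h (W \<pi>))"
  have \<delta>: "0 \<le> \<delta>" using bd[of 0 0] n by auto
  \<comment> \<open>For i = j both sides vanish. For i \<noteq> j the factor n (n - 1) is the one
    from \<open>sum_force2\<close>.\<close>
  have pair: "(\<Sum>\<pi>\<in>perms n. X i j \<pi>) * (real n * (real n - 1)) \<le> (\<Sum>p<n. \<Sum>q<n. (swap_diff a i j p q)\<^sup>2) * T"
    if ij: "i < n" "j < n" for i j
  proof (cases "i = j")
    case False
    have cell: "(\<Sum>\<pi> | \<pi> \<in> perms n \<and> \<pi> i = p \<and> \<pi> j = q. X i j \<pi>) * (real n * (real n - 1))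
        \<le> (swap_diff a i j p q)\<^sup>2 * T" if pq: "p < n" "q < n" for p q
    proof (cases "p = q")
      case True
      have empty: "{\<pi>. \<pi> \<in> perms n \<and> \<pi> i = p \<and> \<pi> j = q} = {}"
        using True False perms_inj by fastforce
      show ?thesis unfolding empty using True by simp
    next
      case pq': False
      have "(\<Sum>\<pi> | \<pi> \<in> perms n \<and> \<pi> i = p \<and> \<pi> j = q. X i j \<pi>) * (real n * (real n - 1))
          = (\<Sum>\<pi>\<in>perms n. X i j (force2 i j p q \<pi>))"
        by (subst sum_force2[OF ij False pq pq']) simp
      also have "\<dots> \<le> (\<Sum>\<pi>\<in>perms n. (swap_diff a i j p q)\<^sup>2 * h (W \<pi>))"
      proof (rule sum_mono)
        fix \<pi> assume \<pi>: "\<pi> \<in> perms n"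
        let ?c = "force2 i j p q \<pi>"
        note c = force2_in[OF \<pi> ij False pq pq']
        have 1: "\<bar>W ?c - W \<pi>\<bar> \<le> 8 * \<delta>"
          unfolding W_def by (rule abs_psum_force2[OF bd \<pi> ij pq])
        have 2: "W (?c \<circ> tswap i j) = W ?c + swap_diff a i j p q"
          unfolding W_def using psum_comp_transpose[OF ij, of a ?c] c by simp
        have 3: "\<bar>swap_diff a i j p q\<bar> \<le> 4 * \<delta>"
          by (rule abs_swap_diff_le[OF bd ij pq])
        have "X i j ?c = (W (?c \<circ> tswap i j) - W ?c) * (g (W (?c \<circ> tswap i j)) - g (W ?c))"
          unfolding X_def D_def using 2 c by simp
        \<comment> \<open>8 \<delta> from forcing and 4 \<delta> from the swap keep both points
          within 12 \<delta> of \<open>W \<pi>\<close>.\<close>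
        also have "\<dots> \<le> (W (?c \<circ> tswap i j) - W ?c)\<^sup>2 * h (W \<pi>)"
          by (rule gh) (use 1 2 3 \<delta> in linarith)+
        finally show "X i j ?c \<le> (swap_diff a i j p q)\<^sup>2 * h (W \<pi>)" using 2 by simp
      qed
      finally show ?thesis by (simp add: T_def sum_distrib_left)
    qed
    have "(\<Sum>\<pi>\<in>perms n. X i j \<pi>)
        = (\<Sum>pq\<in>{..<n} \<times> {..<n}. \<Sum>\<pi> | \<pi> \<in> perms n \<and> (\<pi> i, \<pi> j) = pq. X i j \<pi>)"
      by (rule sum.group[symmetric]) (use perms_less ij in auto)
    also have "\<dots> = (\<Sum>p<n. \<Sum>q<n. \<Sum>\<pi> | \<pi> \<in> perms n \<and> \<pi> i = p \<and> \<pi> j = q. X i j \<pi>)"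
      unfolding sum.cartesian_product by (intro sum.cong) auto
    finally have eq: "(\<Sum>\<pi>\<in>perms n. X i j \<pi>)
        = (\<Sum>p<n. \<Sum>q<n. \<Sum>\<pi> | \<pi> \<in> perms n \<and> \<pi> i = p \<and> \<pi> j = q. X i j \<pi>)" .
    have "(\<Sum>\<pi>\<in>perms n. X i j \<pi>) * (real n * (real n - 1))
        = (\<Sum>p<n. \<Sum>q<n. (\<Sum>\<pi> | \<pi> \<in> perms n \<and> \<pi> i = p \<and> \<pi> j = q. X i j \<pi>) * (real n * (real n - 1)))"
      unfolding eq by (subst sum_distrib_right, rule sum.cong[OF refl], rule sum_distrib_right)
    also have "\<dots> \<le> (\<Sum>p<n. \<Sum>q<n. (swap_diff a i j p q)\<^sup>2 * T)"
      by (intro sum_mono cell) auto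
    also have "\<dots> = (\<Sum>p<n. \<Sum>q<n. (swap_diff a i j p q)\<^sup>2) * T"
      by (simp add: sum_distrib_right)
    finally show ?thesis .
  qed (simp add: X_def D_def)
  \<comment> \<open>The factor 4 n is -2 from exchangeability times -2 n from the regression.
    Together with the n (n - 1) of \<open>sum_force2\<close> it makes up the denominator of
    \<open>swap_var\<close>.\<close>
  have "4 * real n * (\<Sum>\<pi>\<in>perms n. W \<pi> * g (W \<pi>)) = (\<Sum>i<n. \<Sum>j<n. \<Sum>\<pi>\<in>perms n. X i j \<pi>)"
  proof -
    have "(\<Sum>i<n. \<Sum>j<n. \<Sum>\<pi>\<in>perms n. X i j \<pi>)
        = (\<Sum>i<n. \<Sum>j<n. - 2 * (\<Sum>\<pi>\<in>perms n. D i j \<pi> * g (W \<pi>)))"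
      unfolding X_def D_def W_def by (intro sum.cong refl sum_exchangeable) auto
    also have "\<dots> = - 2 * (\<Sum>\<pi>\<in>perms n. (\<Sum>i<n. \<Sum>j<n. D i j \<pi>) * g (W \<pi>))"
    proof -
      have "(\<Sum>i<n. \<Sum>j<n. \<Sum>\<pi>\<in>perms n. D i j \<pi> * g (W \<pi>))
          = (\<Sum>i<n. \<Sum>\<pi>\<in>perms n. \<Sum>j<n. D i j \<pi> * g (W \<pi>))"
        by (rule sum.cong[OF refl], rule sum.swap)
      also have "\<dots> = (\<Sum>\<pi>\<in>perms n. \<Sum>i<n. \<Sum>j<n. D i j \<pi> * g (W \<pi>))"
        by (rule sum.swap)
      finally have eq: "(\<Sum>i<n. \<Sum>j<n. \<Sum>\<pi>\<in>perms n. D i j \<pi> * g (W \<pi>))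
          = (\<Sum>\<pi>\<in>perms n. \<Sum>i<n. \<Sum>j<n. D i j \<pi> * g (W \<pi>))" .
      show ?thesis
        by (simp only: sum_distrib_right eq[symmetric]) (simp only: sum_distrib_left)
    qed
    also have "\<dots> = - 2 * (\<Sum>\<pi>\<in>perms n. (- 2 * real n * W \<pi>) * g (W \<pi>))"
      unfolding D_def W_def using sum_swap_diff[OF tot] by simp
    finally show ?thesis by (simp add: sum_distrib_left mult_ac)
  qed
  then have "4 * real n * (\<Sum>\<pi>\<in>perms n. W \<pi> * g (W \<pi>)) * (real n * (real n - 1))
      = (\<Sum>i<n. \<Sum>j<n. (\<Sum>\<pi>\<in>perms n. X i j \<pi>) * (real n * (real n - 1)))"
    by (simp add: sum_distrib_right)
  also have "\<dots> \<le> (\<Sum>i<n. \<Sum>j<n. (\<Sum>p<n. \<Sum>q<n. (swap_diff a i j p q)\<^sup>2) * T)"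
    by (intro sum_mono pair) auto
  also have "\<dots> = (\<Sum>i<n. \<Sum>j<n. \<Sum>p<n. \<Sum>q<n. (swap_diff a i j p q)\<^sup>2) * T"
    by (simp add: sum_distrib_right)
  also have "\<dots> = swap_var n a * T * (4 * (real n)\<^sup>2 * (real n - 1))"
    unfolding swap_var_def using n by simp
  finally have "(\<Sum>\<pi>\<in>perms n. W \<pi> * g (W \<pi>)) * (4 * (real n)\<^sup>2 * (real n - 1))
      \<le> swap_var n a * T * (4 * (real n)\<^sup>2 * (real n - 1))"
    by (simp only: power2_eq_square mult_ac)
  moreover have "0 < 4 * (real n)\<^sup>2 * (real n - 1)" using n by simp
  ultimately have "(\<Sum>\<pi>\<in>perms n. W \<pi> * g (W \<pi>)) \<le> swap_var n a * T"
    by (rule mult_right_le_imp_le)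
  then show ?thesis by (simp add: T_def W_def)
qed

text \<open>For g(x) = x and h = 1 the increment condition of \<open>psum_stein_le\<close> is an
  equality, and it remains one for -g and -h. The two resulting inequalities identify
  \<open>swap_var\<close> as the second moment.\<close>

lemma sum_psum_square:
  assumes n: "2 \<le> n" and tot: "(\<Sum>i<n. \<Sum>j<n. a i j) = 0"
  shows "(\<Sum>\<pi>\<in>perms n. (psum n a \<pi>)\<^sup>2) = swap_var n a * fact n"
proof -
  define \<delta> where "\<delta> = Max ((\<lambda>(i, j). \<bar>a i j\<bar>) ` ({..<n} \<times> {..<n}))"
  have bd: "\<bar>a i j\<bar> \<le> \<delta>" if "i < n" "j < n" for i j
    unfolding \<delta>_def using that by (intro Max_ge) force+
  have "(\<Sum>\<pi>\<in>perms n. psum n a \<pi> * psum n a \<pi>) \<le> swap_var n a * (\<Sum>\<pi>\<in>perms n. 1)"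
    by (rule psum_stein_le[OF n tot bd, where g = "\<lambda>x. x" and h = "\<lambda>_. 1"])
       (auto simp: power2_eq_square)
  moreover have "(\<Sum>\<pi>\<in>perms n. psum n a \<pi> * (- psum n a \<pi>)) \<le> swap_var n a * (\<Sum>\<pi>\<in>perms n. - 1)"
    by (rule psum_stein_le[OF n tot bd, where g = "\<lambda>x. - x" and h = "\<lambda>_. - 1"])
       (auto simp: power2_eq_square algebra_simps)
  ultimately show ?thesis
    by (simp add: card_perms power2_eq_square sum_negf)
qed

lemma sum_abs_psum_le:
  assumes "2 \<le> n" "(\<Sum>i<n. \<Sum>j<n. a i j) = 0" "swap_var n a = 1"
  shows "(\<Sum>\<pi>\<in>perms n. \<bar>psum n a \<pi>\<bar>) \<le> fact n"
proof -
  have "2 * \<bar>x\<bar> \<le> 1 + x\<^sup>2" for x :: real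
    using zero_le_power2[of "\<bar>x\<bar> - 1"] by (simp add: power2_eq_square algebra_simps)
  then have "2 * (\<Sum>\<pi>\<in>perms n. \<bar>psum n a \<pi>\<bar>) \<le> (\<Sum>\<pi>\<in>perms n. 1 + (psum n a \<pi>)\<^sup>2)"
    unfolding sum_distrib_left by (intro sum_mono) auto
  also have "\<dots> = 2 * fact n"
    using sum_psum_square[OF assms(1,2)] assms(3) by (simp add: sum.distrib card_perms)
  finally show ?thesis by simp
qed

theorem combinatorial_berry_esseen:
  assumes n: "2 \<le> n" and tot: "(\<Sum>i<n. \<Sum>j<n. a i j) = 0"
    and bd: "\<And>i j. i < n \<Longrightarrow> j < n \<Longrightarrow> \<bar>a i j\<bar> \<le> \<delta>"
    and var: "swap_var n a = 1"
  shows "\<bar>real (card {\<pi> \<in> perms n. psum n a \<pi> \<le> t}) / fact n - Phi t\<bar> \<le> 12 * (mills 0 + 3) * \<delta>"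
proof -
  define W where "W = psum n a"
  define \<epsilon> where "\<epsilon> = 12 * \<delta>"
  define P where "P = (\<lambda>t. real (card {\<pi> \<in> perms n. W \<pi> \<le> t}))"
  have \<epsilon>: "0 \<le> \<epsilon>" using bd[of 0 0] n by (auto simp: \<epsilon>_def)
  have P: "(\<Sum>\<pi>\<in>perms n. of_bool (W \<pi> \<le> t)) = P t" for t
    unfolding P_def by (simp add: of_bool_def sum.If_cases Int_def)
  have W1: "(\<Sum>\<pi>\<in>perms n. \<bar>W \<pi>\<bar>) \<le> fact n"
    unfolding W_def by (rule sum_abs_psum_le[OF n tot var])
  have c: "(\<Sum>\<pi>\<in>perms n. c) = fact n * c" for c :: real by (simp add: card_perms)
  have err: "(\<Sum>\<pi>\<in>perms n. \<epsilon> * (mills 0 + 2 * \<bar>W \<pi>\<bar>)) \<le> fact n * (\<epsilon> * (mills 0 + 2))"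
  proof -
    have "(\<Sum>\<pi>\<in>perms n. \<epsilon> * (mills 0 + 2 * \<bar>W \<pi>\<bar>)) = \<epsilon> * (fact n * mills 0 + 2 * (\<Sum>\<pi>\<in>perms n. \<bar>W \<pi>\<bar>))"
      by (simp add: sum.distrib card_perms flip: sum_distrib_left)
    also have "\<dots> \<le> \<epsilon> * (fact n * mills 0 + 2 * fact n)"
      by (intro mult_left_mono add_left_mono W1 \<epsilon>) auto
    finally show ?thesis by (simp add: algebra_simps)
  qed
  have up: "fact n * Phi z \<le> P (z + \<epsilon>) + fact n * (\<epsilon> * (mills 0 + 2))" for z
  proof -
    have "(\<Sum>\<pi>\<in>perms n. W \<pi> * stein z (W \<pi>)) \<le> swap_var n a * (\<Sum>\<pi>\<in>perms n.
        W \<pi> * stein z (W \<pi>) + \<epsilon> * (mills 0 + 2 * \<bar>W \<pi>\<bar>) + of_bool (W \<pi> \<le> z + \<epsilon>) - Phi z)"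
      unfolding W_def \<epsilon>_def
      by (rule psum_stein_le[OF n tot bd, where g = "stein z" and
          h = "\<lambda>w. w * stein z w + 12 * \<delta> * (mills 0 + 2 * \<bar>w\<bar>) + of_bool (w \<le> z + 12 * \<delta>) - Phi z"])
         (assumption | rule stein_increment_upper)+
    then have "0 \<le> (\<Sum>\<pi>\<in>perms n. \<epsilon> * (mills 0 + 2 * \<bar>W \<pi>\<bar>)) + P (z + \<epsilon>) - fact n * Phi z"
      by (simp add: var sum.distrib sum_subtractf P c del: sum_constant)
    then show ?thesis using err by linarith
  qed
  have lo: "P (z - \<epsilon>) \<le> fact n * Phi z + fact n * (\<epsilon> * (mills 0 + 2))" for z
  proof -
    have "(\<Sum>\<pi>\<in>perms n. W \<pi> * (- stein z (W \<pi>))) \<le> swap_var n a * (\<Sum>\<pi>\<in>perms n.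
        - (W \<pi> * stein z (W \<pi>) - \<epsilon> * (mills 0 + 2 * \<bar>W \<pi>\<bar>) + of_bool (W \<pi> \<le> z - \<epsilon>) - Phi z))"
      unfolding W_def \<epsilon>_def
    proof (rule psum_stein_le[OF n tot bd, where g = "\<lambda>x. - stein z x" and
          h = "\<lambda>w. - (w * stein z w - 12 * \<delta> * (mills 0 + 2 * \<bar>w\<bar>) + of_bool (w \<le> z - 12 * \<delta>) - Phi z)"])
      fix w x y :: real
      assume "\<bar>x - w\<bar> \<le> 12 * \<delta>" "\<bar>y - w\<bar> \<le> 12 * \<delta>"
      from stein_increment_lower[OF this, of z]
      show "(y - x) * (- stein z y - - stein z x) \<le> (y - x)\<^sup>2 *
        - (w * stein z w - 12 * \<delta> * (mills 0 + 2 * \<bar>w\<bar>) + of_bool (w \<le> z - 12 * \<delta>) - Phi z)"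
        unfolding mult_minus_right minus_diff_minus by (simp add: algebra_simps)
    qed auto
    then have "0 \<le> (\<Sum>\<pi>\<in>perms n. \<epsilon> * (mills 0 + 2 * \<bar>W \<pi>\<bar>)) - P (z - \<epsilon>) + fact n * Phi z"
      by (simp add: var sum.distrib sum_subtractf sum_negf P c del: sum_constant)
    then show ?thesis using err by linarith
  qed
  let ?E = "12 * (mills 0 + 3) * \<delta>"
  have E: "?E = \<epsilon> * (mills 0 + 2) + \<epsilon>" by (simp add: \<epsilon>_def algebra_simps)
  have "fact n * Phi t \<le> fact n * (Phi (t - \<epsilon>) + \<epsilon>)"
    using Phi_lipschitz[of "t - \<epsilon>" t] \<epsilon> by (intro mult_left_mono) auto
  also have "\<dots> \<le> P t + fact n * ?E"
    using up[of "t - \<epsilon>"] unfolding E by (simp add: algebra_simps)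
  finally have 1: "Phi t \<le> P t / fact n + ?E"
    by (simp add: field_simps)
  have "P t \<le> fact n * Phi (t + \<epsilon>) + fact n * (\<epsilon> * (mills 0 + 2))"
    using lo[of "t + \<epsilon>"] by simp
  also have "\<dots> \<le> fact n * (Phi t + \<epsilon>) + fact n * (\<epsilon> * (mills 0 + 2))"
    using Phi_lipschitz[of t "t + \<epsilon>"] \<epsilon> by (intro add_right_mono mult_left_mono) auto
  also have "\<dots> = fact n * (Phi t + ?E)" unfolding E by (simp add: algebra_simps)
  finally have 2: "P t / fact n \<le> Phi t + ?E"
    by (simp add: field_simps)
  from 1 2 show ?thesis unfolding P_def W_def by linarith
qed

section \<open>Complete randomization\<close>

lemma exists_levels:
  fixes Nq :: "nat \<Rightarrow> nat"
  shows "\<exists>lev. \<forall>q<Q. (\<forall>i<\<Sum>q<Q. Nq q. lev i < Q) \<and> card {i \<in> {..<\<Sum>q<Q. Nq q}. lev i = q} = Nq q"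
proof (induction Q)
  case (Suc Q)
  define M where "M = (\<Sum>q<Q. Nq q)"
  from Suc obtain lev where lev: "\<And>q i. q < Q \<Longrightarrow> i < M \<Longrightarrow> lev i < Q"
    "\<And>q. q < Q \<Longrightarrow> card {i \<in> {..<M}. lev i = q} = Nq q" unfolding M_def by blast
  \<comment> \<open>For Q = 0 the induction hypothesis says nothing about \<open>lev\<close>, but
    then there are no units.\<close>
  have M0: "Q = 0 \<Longrightarrow> M = 0" by (simp add: M_def)
  have lt: "lev i < Q" if "i < M" for i using lev(1)[of 0 i] that M0 by (cases "Q = 0") auto
  define lev' where "lev' = (\<lambda>i. if i < M then lev i else Q)"
  have sum: "(\<Sum>q<Suc Q. Nq q) = M + Nq Q" by (simp add: M_def)
  have "lev' i < Suc Q" for i using lt[of i] by (auto simp: lev'_def)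
  moreover have "card {i \<in> {..<M + Nq Q}. lev' i = q} = Nq q" if "q < Suc Q" for q
  proof (cases "q = Q")
    case True
    have iff: "lev' i = q \<longleftrightarrow> M \<le> i" for i using lt[of i] True by (auto simp: lev'_def)
    have "{i \<in> {..<M + Nq Q}. lev' i = q} = {i \<in> {..<M + Nq Q}. M \<le> i}"
      by (simp only: iff)
    also have "\<dots> = {M..<M + Nq Q}" by auto
    finally have "{i \<in> {..<M + Nq Q}. lev' i = q} = {M..<M + Nq Q}" .
    then show ?thesis using True by simp
  next
    case False
    then have "{i \<in> {..<M + Nq Q}. lev' i = q} = {i \<in> {..<M}. lev i = q}"
      by (auto simp: lev'_def)
    then show ?thesis using lev(2)[of q] False that by simp
  qed
  ultimately show ?case unfolding sum by blast
qed auto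

lemma exists_assignment:
  assumes sum: "(\<Sum>q<Q. Nq q) = N" and "0 < N"
  shows "\<exists>L. L \<in> assignments N Q Nq"
proof -
  have "0 < Q" using assms by (cases Q) auto
  with exists_levels[of Q Nq] obtain lev where
    lev: "\<And>i. i < N \<Longrightarrow> lev i < Q" "\<And>q. q < Q \<Longrightarrow> card {i \<in> {..<N}. lev i = q} = Nq q"
    unfolding sum by blast
  define L where "L = restrict lev {..<N}"
  have "{i \<in> {..<N}. L i = q} = {i \<in> {..<N}. lev i = q}" for q by (auto simp: L_def)
  then have "L \<in> assignments N Q Nq" using lev by (simp add: assignments_def) (auto simp: L_def)
  then show ?thesis by blast
qed

lemma finite_assignments: "finite (assignments N Q Nq)"
  unfolding assignments_def by (rule finite_subset[of _ "{..<N} \<rightarrow>\<^sub>E {..<Q}"]) (auto intro: finite_PiE)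

lemma assignments_less: "Z \<in> assignments N Q Nq \<Longrightarrow> i < N \<Longrightarrow> Z i < Q"
  by (auto simp: assignments_def)

text \<open>With the group sizes fixed, both label functions have the same multiset of values, so
  they differ by a permutation of the units.\<close>

lemma assignments_same_orbit:
  assumes "Z \<in> assignments N Q Nq" "L \<in> assignments N Q Nq"
  obtains \<sigma> where "\<sigma> \<in> perms N" "\<And>i. i < N \<Longrightarrow> Z i = L (\<sigma> i)"
proof -
  have "image_mset Z (mset_set {..<N}) = image_mset L (mset_set {..<N})"
  proof (rule multiset_eqI)
    fix q
    have "card {i \<in> {..<N}. Z i = q} = card {i \<in> {..<N}. L i = q}"
    proof (cases "q < Q")
      case True
      then show ?thesis using assms by (simp add: assignments_def)
    next
      case False
      then have "{i \<in> {..<N}. Z i = q} = {}" "{i \<in> {..<N}. L i = q} = {}"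
        using assignments_less[OF assms(1)] assignments_less[OF assms(2)] by auto
      then show ?thesis by metis
    qed
    then show "count (image_mset Z (mset_set {..<N})) q = count (image_mset L (mset_set {..<N})) q"
      by (simp add: count_image_mset' Int_def vimage_def conj_commute eq_commute)
  qed
  from image_mset_eq_implies_permutes[OF finite_lessThan this]
  obtain p where "p permutes {..<N}" "\<forall>x\<in>{..<N}. Z x = L (p x)" .
  then show ?thesis by (intro that[of p]) simp_all
qed

text \<open>Permuting the units acts transitively on assignments, so all fibres of
  \<open>\<pi> \<mapsto> L \<circ> \<pi>\<close> have the same size.\<close>

lemma card_perms_assignments:
  assumes L: "L \<in> assignments N Q Nq"
  obtains k where "k > 0"
    and "\<And>B. card {\<pi> \<in> perms N. restrict (L \<circ> \<pi>) {..<N} \<in> B} = k * card (assignments N Q Nq \<inter> B)"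
proof -
  define \<phi> where "\<phi> = (\<lambda>\<pi>. restrict (L \<circ> \<pi>) {..<N})"
  \<comment> \<open>k is the order of the stabiliser of \<open>L\<close>: the number of permutations
    that leave its labels unchanged.\<close>
  define k where "k = card {\<pi> \<in> perms N. \<phi> \<pi> = restrict L {..<N}}"
  have ext: "Z = restrict Z {..<N}" if "Z \<in> assignments N Q Nq" for Z
    using that by (auto simp: assignments_def PiE_restrict)
  have \<phi>: "\<phi> \<pi> \<in> assignments N Q Nq" if \<pi>: "\<pi> \<in> perms N" for \<pi>
  proof -
    have "card {i \<in> {..<N}. \<phi> \<pi> i = q} = Nq q" if "q < Q" for q
    proof -
      have "bij_betw \<pi> {i \<in> {..<N}. \<phi> \<pi> i = q} {i \<in> {..<N}. L i = q}"
      proof (rule bij_betwI')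
        show "\<pi> x = \<pi> y \<longleftrightarrow> x = y" for x y using perms_inj[OF \<pi>] by simp
        show "\<pi> x \<in> {i \<in> {..<N}. L i = q}" if "x \<in> {i \<in> {..<N}. \<phi> \<pi> i = q}" for x
          using that perms_less[OF \<pi>] by (auto simp: \<phi>_def)
        show "\<exists>x\<in>{i \<in> {..<N}. \<phi> \<pi> i = q}. y = \<pi> x" if "y \<in> {i \<in> {..<N}. L i = q}" for y
        proof -
          have "y \<in> \<pi> ` {..<N}" using that \<pi> permutes_image[of \<pi> "{..<N}"] by auto
          then show ?thesis using that by (auto simp: \<phi>_def)
        qed
      qed
      then have "card {i \<in> {..<N}. \<phi> \<pi> i = q} = card {i \<in> {..<N}. L i = q}"
        by (rule bij_betw_same_card)
      then show ?thesis using L that by (simp add: assignments_def)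
    qed
    moreover have "\<phi> \<pi> \<in> {..<N} \<rightarrow>\<^sub>E {..<Q}"
      using perms_less[OF \<pi>] assignments_less[OF L] by (auto simp: \<phi>_def)
    ultimately show ?thesis by (simp add: assignments_def)
  qed
  have fibre: "card {\<pi> \<in> perms N. \<phi> \<pi> = Z} = k" if Z: "Z \<in> assignments N Q Nq" for Z
  proof -
    obtain \<sigma> where \<sigma>: "\<sigma> \<in> perms N" "\<And>i. i < N \<Longrightarrow> Z i = L (\<sigma> i)"
      using assignments_same_orbit[OF Z L] by blast
    have \<sigma>p: "\<sigma> permutes {..<N}" using \<sigma> by simp
    have inv: "Hilbert_Choice.inv \<sigma> \<in> perms N" using permutes_inv[OF \<sigma>p] by simp
    have Zr: "Z = restrict (L \<circ> \<sigma>) {..<N}"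
      by (subst ext[OF Z]) (auto simp: restrict_def fun_eq_iff \<sigma>(2))
    \<comment> \<open>Since Z is L \<circ> \<sigma> on the units, composing with \<sigma> on the
      right carries the fibre over L onto the fibre over Z.\<close>
    have "bij_betw (\<lambda>\<pi>. \<pi> \<circ> \<sigma>) {\<pi> \<in> perms N. \<phi> \<pi> = restrict L {..<N}} {\<pi> \<in> perms N. \<phi> \<pi> = Z}"
    proof (rule bij_betw_byWitness[where f' = "\<lambda>\<pi>. \<pi> \<circ> Hilbert_Choice.inv \<sigma>"])
      show "\<forall>\<pi>\<in>{\<pi> \<in> perms N. \<phi> \<pi> = restrict L {..<N}}. \<pi> \<circ> \<sigma> \<circ> Hilbert_Choice.inv \<sigma> = \<pi>"
        using permutes_inv_o[OF \<sigma>p] by (auto simp: comp_assoc)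
      show "\<forall>\<pi>\<in>{\<pi> \<in> perms N. \<phi> \<pi> = Z}. \<pi> \<circ> Hilbert_Choice.inv \<sigma> \<circ> \<sigma> = \<pi>"
        using permutes_inv_o[OF \<sigma>p] by (auto simp: comp_assoc)
      show "(\<lambda>\<pi>. \<pi> \<circ> \<sigma>) ` {\<pi> \<in> perms N. \<phi> \<pi> = restrict L {..<N}} \<subseteq> {\<pi> \<in> perms N. \<phi> \<pi> = Z}"
      proof (clarsimp, intro conjI)
        fix \<pi> assume \<pi>: "\<pi> permutes {..<N}" "\<phi> \<pi> = restrict L {..<N}"
        show "\<pi> \<circ> \<sigma> permutes {..<N}" using \<pi> \<sigma>p by (intro permutes_compose)
        have "L (\<pi> i) = L i" if "i < N" for i
          using fun_cong[OF \<pi>(2), of i] that by (simp add: \<phi>_def)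
        then show "\<phi> (\<pi> \<circ> \<sigma>) = Z"
          unfolding Zr \<phi>_def using perms_less[OF \<sigma>(1)] by (auto simp: restrict_def fun_eq_iff)
      qed
      show "(\<lambda>\<pi>. \<pi> \<circ> Hilbert_Choice.inv \<sigma>) ` {\<pi> \<in> perms N. \<phi> \<pi> = Z} \<subseteq> {\<pi> \<in> perms N. \<phi> \<pi> = restrict L {..<N}}"
      proof (clarsimp, intro conjI)
        fix \<pi> assume \<pi>: "\<pi> permutes {..<N}" "Z = \<phi> \<pi>"
        show "\<pi> \<circ> Hilbert_Choice.inv \<sigma> permutes {..<N}" using \<pi> inv by (intro permutes_compose) auto
        have "L (\<pi> i) = L (\<sigma> i)" if "i < N" for i
          using \<sigma>(2)[OF that] \<pi>(2) that by (simp add: \<phi>_def)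
        then have "L (\<pi> (Hilbert_Choice.inv \<sigma> i)) = L i" if "i < N" for i
          using perms_less[OF inv that] permutes_inverses(1)[OF \<sigma>p] by simp
        then show "\<phi> (\<pi> \<circ> Hilbert_Choice.inv \<sigma>) = restrict L {..<N}"
          by (auto simp: \<phi>_def restrict_def fun_eq_iff)
      qed
    qed
    from bij_betw_same_card[OF this] show ?thesis unfolding k_def by (rule sym)
  qed
  have "id \<in> {\<pi> \<in> perms N. \<phi> \<pi> = restrict L {..<N}}" by (simp add: permutes_id \<phi>_def)
  moreover have "finite {\<pi> \<in> perms N. \<phi> \<pi> = restrict L {..<N}}"
    by (rule finite_subset[OF _ finite_perms[of N]]) auto
  ultimately have "k > 0" unfolding k_def by (metis card_gt_0_iff empty_iff)
  moreover have "card {\<pi> \<in> perms N. \<phi> \<pi> \<in> B} = k * card (assignments N Q Nq \<inter> B)" for B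
  proof -
    have "card {\<pi> \<in> perms N. \<phi> \<pi> \<in> B} = (\<Sum>\<pi>\<in>{\<pi> \<in> perms N. \<phi> \<pi> \<in> B}. 1)" by simp
    also have "\<dots> = (\<Sum>Z\<in>assignments N Q Nq \<inter> B. \<Sum>\<pi> | \<pi> \<in> {\<pi> \<in> perms N. \<phi> \<pi> \<in> B} \<and> \<phi> \<pi> = Z. 1)"
    proof (rule sum.group[symmetric])
      show "finite {\<pi> \<in> perms N. \<phi> \<pi> \<in> B}"
        by (rule finite_subset[OF _ finite_perms[of N]]) auto
    qed (use \<phi> finite_assignments in auto)
    also have "\<dots> = (\<Sum>Z\<in>assignments N Q Nq \<inter> B. k)"
    proof (rule sum.cong[OF refl])
      fix Z assume Z: "Z \<in> assignments N Q Nq \<inter> B"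
      then have "{\<pi>. \<pi> \<in> {\<pi> \<in> perms N. \<phi> \<pi> \<in> B} \<and> \<phi> \<pi> = Z} = {\<pi> \<in> perms N. \<phi> \<pi> = Z}" by auto
      then show "(\<Sum>\<pi> | \<pi> \<in> {\<pi> \<in> perms N. \<phi> \<pi> \<in> B} \<and> \<phi> \<pi> = Z. 1) = k"
        using fibre[of Z] Z by simp
    qed
    finally show ?thesis by simp
  qed
  ultimately show ?thesis using that unfolding \<phi>_def by blast
qed

text \<open>Fibres of equal size push the uniform distribution on permutations forward to the
  uniform distribution on assignments.\<close>

lemma CR_prob_eq_perms:
  assumes L: "L \<in> assignments N Q Nq"
  shows "measure_pmf.prob (CR N Q Nq) B
     = real (card {\<pi> \<in> perms N. restrict (L \<circ> \<pi>) {..<N} \<in> B}) / fact N"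
proof -
  let ?A = "assignments N Q Nq"
  obtain k where k: "k > 0"
    "\<And>B. card {\<pi> \<in> perms N. restrict (L \<circ> \<pi>) {..<N} \<in> B} = k * card (?A \<inter> B)"
    using card_perms_assignments[OF L] by blast
  have fact: "fact N = k * card ?A" using k(2)[of UNIV] card_perms[of N] by simp
  have "?A \<noteq> {}" using L by auto
  then have "measure_pmf.prob (CR N Q Nq) B = card (?A \<inter> B) / card ?A"
    unfolding CR_def by (rule measure_pmf_of_set) (rule finite_assignments)
  also have "\<dots> = real (k * card (?A \<inter> B)) / real (k * card ?A)" using k(1) by simp
  also have "\<dots> = real (card {\<pi> \<in> perms N. restrict (L \<circ> \<pi>) {..<N} \<in> B}) / fact N"
    by (simp only: k(2) flip: fact) simp
  finally show ?thesis .
qed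

section \<open>The variance under complete randomization\<close>

lemma sum_swap_diff_square:
  assumes col: "\<And>j. j < n \<Longrightarrow> (\<Sum>i<n. a i j) = (0::real)"
  shows "(\<Sum>i<n. \<Sum>j<n. \<Sum>p<n. \<Sum>q<n. (swap_diff a i j p q)\<^sup>2)
     = 4 * (real n)\<^sup>2 * (\<Sum>i<n. \<Sum>j<n. (a i j)\<^sup>2) - 4 * real n * (\<Sum>i<n. (\<Sum>j<n. a i j)\<^sup>2)"
proof -
  define R where "R = (\<lambda>i. \<Sum>q<n. a i q)"
  define G where "G = (\<lambda>i j. \<Sum>q<n. a i q * a j q)"
  have pq: "(\<Sum>p<n. \<Sum>q<n. (swap_diff a i j p q)\<^sup>2)
      = 2 * real n * (G i i + G j j) + 4 * R i * R j - 2 * (R i)\<^sup>2 - 2 * (R j)\<^sup>2 - 4 * real n * G i j" for i j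
  proof -
    have "(swap_diff a i j p q)\<^sup>2 = a i q * a i q + a j p * a j p + a i p * a i p + a j q * a j q
        + 2 * (a j p * a i q) + 2 * (a i p * a j q) - 2 * (a i p * a i q) - 2 * (a i q * a j q)
        - 2 * (a i p * a j p) - 2 * (a j p * a j q)" for p q
      unfolding swap_diff_def by (simp add: power2_eq_square algebra_simps)
    then have "(\<Sum>p<n. \<Sum>q<n. (swap_diff a i j p q)\<^sup>2)
      = n * G i i + n * G j j + n * G i i + n * G j j
        + 2 * (R j * R i) + 2 * (R i * R j) - 2 * (R i * R i) - 2 * (n * G i j)
        - 2 * (n * G i j) - 2 * (R j * R j)"
      by (simp add: sum.distrib sum_subtractf G_def R_def flip: sum_distrib_left sum_distrib_right)
    then show ?thesis by (simp add: power2_eq_square algebra_simps)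
  qed
  \<comment> \<open>Zero column sums eliminate all products of a row i with a row j: the row sums
    \<open>R i\<close> add up to 0, and so do the Gram entries \<open>G i j\<close>.\<close>
  have R0: "(\<Sum>i<n. R i) = 0"
    unfolding R_def by (subst sum.swap) (simp add: col)
  have G0: "(\<Sum>i<n. \<Sum>j<n. G i j) = 0"
  proof -
    have "(\<Sum>j<n. G i j) = 0" for i
      unfolding G_def by (subst sum.swap) (simp add: col flip: sum_distrib_left)
    then show ?thesis by simp
  qed
  have RR: "(\<Sum>i<n. \<Sum>j<n. 4 * R i * R j) = 0"
    by (simp add: R0 flip: sum_distrib_left)
  have GG: "(\<Sum>i<n. \<Sum>j<n. 4 * real n * G i j) = 0"
  proof -
    have "(\<Sum>i<n. \<Sum>j<n. 4 * real n * G i j) = 4 * real n * (\<Sum>i<n. \<Sum>j<n. G i j)"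
      by (simp add: sum_distrib_left mult.assoc)
    then show ?thesis using G0 by simp
  qed
  have "(\<Sum>i<n. \<Sum>j<n. \<Sum>p<n. \<Sum>q<n. (swap_diff a i j p q)\<^sup>2)
     = (\<Sum>i<n. \<Sum>j<n. 2 * real n * G i i) + (\<Sum>i<n. \<Sum>j<n. 2 * real n * G j j)
       - (\<Sum>i<n. \<Sum>j<n. 2 * (R i)\<^sup>2) - (\<Sum>i<n. \<Sum>j<n. 2 * (R j)\<^sup>2)"
    unfolding pq by (simp only: sum.distrib sum_subtractf distrib_left RR GG)
  also have "\<dots> = 4 * (real n)\<^sup>2 * (\<Sum>i<n. G i i) - 4 * real n * (\<Sum>i<n. (R i)\<^sup>2)"
    by (simp flip: sum_distrib_left) (simp add: power2_eq_square algebra_simps)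
  finally show ?thesis by (simp add: G_def R_def power2_eq_square)
qed

lemma swap_var_col_zero:
  assumes "2 \<le> n" "\<And>j. j < n \<Longrightarrow> (\<Sum>i<n. a i j) = (0::real)"
  shows "swap_var n a = ((\<Sum>i<n. \<Sum>j<n. (a i j)\<^sup>2) - (\<Sum>i<n. (\<Sum>j<n. a i j)\<^sup>2) / n) / (real n - 1)"
proof -
  have eq: "(\<Sum>i<n. \<Sum>j<n. \<Sum>p<n. \<Sum>q<n. (swap_diff a i j p q)\<^sup>2)
     = 4 * (real n)\<^sup>2 * (\<Sum>i<n. \<Sum>j<n. (a i j)\<^sup>2) - 4 * real n * (\<Sum>i<n. (\<Sum>j<n. a i j)\<^sup>2)"
    by (rule sum_swap_diff_square) (rule assms(2))
  show ?thesis unfolding swap_var_def eq using assms(1)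
    by (simp add: field_simps power2_eq_square)
qed

lemma sum_levels:
  fixes h :: "nat \<Rightarrow> real"
  assumes L: "L \<in> assignments N Q Nq"
  shows "(\<Sum>j<N. h (L j)) = (\<Sum>q<Q. real (Nq q) * h q)"
proof -
  have "(\<Sum>j<N. h (L j)) = (\<Sum>q<Q. \<Sum>j | j \<in> {..<N} \<and> L j = q. h (L j))"
    by (rule sum.group[symmetric]) (use assignments_less[OF L] in auto)
  also have "\<dots> = (\<Sum>q<Q. real (Nq q) * h q)"
  proof (rule sum.cong[OF refl])
    fix q assume "q \<in> {..<Q}"
    then have "card {j. j \<in> {..<N} \<and> L j = q} = Nq q" using L by (simp add: assignments_def)
    moreover have "(\<Sum>j | j \<in> {..<N} \<and> L j = q. h (L j)) = (\<Sum>j | j \<in> {..<N} \<and> L j = q. h q)"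
      by (rule sum.cong) auto
    ultimately show "(\<Sum>j | j \<in> {..<N} \<and> L j = q. h (L j)) = real (Nq q) * h q" by simp
  qed
  finally show ?thesis .
qed

lemma sum_centered:
  assumes "0 < N"
  shows "(\<Sum>i<N. Y i q - Ybar N Y q) = 0"
  using assms by (simp add: sum_subtractf Ybar_def)

text \<open>The columns j of the array are slots with label \<open>L j\<close>. The squared entries
  produce diag (S(q,q) / N_q) and the row sums produce S / N, so the result is the quadratic form of
  \<open>VY\<close> at c. Centring the outcomes makes the column sums vanish.\<close>

lemma swap_var_levels:
  assumes N: "2 \<le> N" and L: "L \<in> assignments N Q Nq" and pos: "\<And>q. q < Q \<Longrightarrow> 1 \<le> Nq q"
  shows "swap_var N (\<lambda>i j. c (L j) * (Y i (L j) - Ybar N Y (L j)) / real (Nq (L j)))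
     = (\<Sum>q<Q. (c q)\<^sup>2 * (Scov N Y q q / real (Nq q)))
       - (\<Sum>q<Q. \<Sum>q'<Q. c q * c q' * (Scov N Y q q' / real N))"
proof -
  define d where "d = (\<lambda>i q. Y i q - Ybar N Y q)"
  define a where "a = (\<lambda>i j. c (L j) * d i (L j) / real (Nq (L j)))"
  have Sc: "Scov N Y q q' = (\<Sum>i<N. d i q * d i q') / (real N - 1)" for q q'
    by (simp add: Scov_def d_def)
  have N1: "real N - 1 \<noteq> 0" using N by simp
  have col: "(\<Sum>i<N. a i j) = 0" for j
    unfolding a_def d_def using sum_centered[of N Y "L j"] N
    by (simp flip: sum_distrib_left sum_divide_distrib)
  have "(\<Sum>i<N. \<Sum>j<N. (a i j)\<^sup>2) = (\<Sum>i<N. \<Sum>q<Q. real (Nq q) * (c q * d i q / real (Nq q))\<^sup>2)"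
    unfolding a_def
    by (intro sum.cong refl sum_levels[OF L, where h = "\<lambda>q. (c q * d _ q / real (Nq q))\<^sup>2"])
  also have "\<dots> = (\<Sum>i<N. \<Sum>q<Q. (c q)\<^sup>2 * (d i q * d i q) / real (Nq q))"
    using pos by (intro sum.cong refl) (auto simp: power2_eq_square)
  also have "\<dots> = (\<Sum>q<Q. \<Sum>i<N. (c q)\<^sup>2 * (d i q * d i q) / real (Nq q))"
    by (rule sum.swap)
  also have "\<dots> = (real N - 1) * (\<Sum>q<Q. (c q)\<^sup>2 * (Scov N Y q q / real (Nq q)))"
    using N1 unfolding Sc
    by (simp add: sum_distrib_left) (simp add: mult_ac sum_distrib_left sum_divide_distrib)
  finally have A: "(\<Sum>i<N. \<Sum>j<N. (a i j)\<^sup>2)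
      = (real N - 1) * (\<Sum>q<Q. (c q)\<^sup>2 * (Scov N Y q q / real (Nq q)))" .
  have "(\<Sum>j<N. a i j) = (\<Sum>q<Q. c q * d i q)" for i
  proof -
    have "(\<Sum>j<N. a i j) = (\<Sum>q<Q. real (Nq q) * (c q * d i q / real (Nq q)))"
      unfolding a_def by (rule sum_levels[OF L, where h = "\<lambda>q. c q * d i q / real (Nq q)"])
    also have "\<dots> = (\<Sum>q<Q. c q * d i q)"
      by (intro sum.cong refl) (auto dest: pos)
    finally show ?thesis .
  qed
  then have "(\<Sum>i<N. (\<Sum>j<N. a i j)\<^sup>2) = (\<Sum>i<N. \<Sum>q<Q. \<Sum>q'<Q. c q * c q' * (d i q * d i q'))"
    by (simp add: power2_eq_square sum_product mult_ac)
  also have "\<dots> = (\<Sum>q<Q. \<Sum>q'<Q. \<Sum>i<N. c q * c q' * (d i q * d i q'))"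
    by (subst sum.swap, rule sum.cong[OF refl], rule sum.swap)
  also have "\<dots> = (\<Sum>q<Q. \<Sum>q'<Q. c q * c q' * ((real N - 1) * Scov N Y q q'))"
    using N1 unfolding Sc by (simp flip: sum_distrib_left)
  also have "\<dots> = real N * (real N - 1) * (\<Sum>q<Q. \<Sum>q'<Q. c q * c q' * (Scov N Y q q' / real N))"
    using N by (simp add: sum_distrib_left mult_ac)
  finally have B: "(\<Sum>i<N. (\<Sum>j<N. a i j)\<^sup>2)
      = real N * (real N - 1) * (\<Sum>q<Q. \<Sum>q'<Q. c q * c q' * (Scov N Y q q' / real N))" .
  have "swap_var N a = (\<Sum>q<Q. (c q)\<^sup>2 * (Scov N Y q q / real (Nq q)))
       - (\<Sum>q<Q. \<Sum>q'<Q. c q * c q' * (Scov N Y q q' / real N))"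
    unfolding swap_var_col_zero[OF N col] A B using N by (simp add: field_simps)
  then show ?thesis by (simp add: a_def d_def)
qed

lemma berry_esseen_CR:
  fixes c :: "nat \<Rightarrow> real"
  assumes pos: "\<And>q. q < Q \<Longrightarrow> 1 \<le> Nq q" and sum: "(\<Sum>q<Q. Nq q) = N" and N: "2 \<le> N"
    and var: "(\<Sum>q<Q. (c q)\<^sup>2 * (Scov N Y q q / real (Nq q)))
       - (\<Sum>q<Q. \<Sum>q'<Q. c q * c q' * (Scov N Y q q' / real N)) = 1"
    and bd: "\<And>i q. i < N \<Longrightarrow> q < Q \<Longrightarrow> \<bar>c q * (Y i q - Ybar N Y q) / real (Nq q)\<bar> \<le> \<delta>"
  shows "\<bar>measure_pmf.prob (CR N Q Nq)
      {Z. (\<Sum>q<Q. c q * ((\<Sum>i\<in>{i \<in> {..<N}. Z i = q}. Y i q) / real (Nq q) - Ybar N Y q)) \<le> t} - Phi t\<bar>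
     \<le> 12 * (mills 0 + 3) * \<delta>"
proof -
  obtain L where L: "L \<in> assignments N Q Nq"
    using exists_assignment[OF sum] N by auto
  let ?g = "\<lambda>Z. \<Sum>q<Q. c q * ((\<Sum>i\<in>{i \<in> {..<N}. Z i = q}. Y i q) / real (Nq q) - Ybar N Y q)"
  define f where "f = (\<lambda>i q. c q * (Y i q - Ybar N Y q) / real (Nq q))"
  define a where "a = (\<lambda>i j. f i (L j))"
  have g: "?g Z = (\<Sum>i<N. f i (Z i))" if Z: "Z \<in> assignments N Q Nq" for Z
  proof -
    have "(\<Sum>i<N. f i (Z i)) = (\<Sum>q<Q. \<Sum>i\<in>{i \<in> {..<N}. Z i = q}. f i (Z i))"
      by (rule sum.group[symmetric]) (use assignments_less[OF Z] in auto)
    also have "\<dots> = ?g Z"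
    proof (rule sum.cong[OF refl])
      fix q assume q: "q \<in> {..<Q}"
      then have card: "card {i \<in> {..<N}. Z i = q} = Nq q" using Z by (simp add: assignments_def)
      have "(\<Sum>i\<in>{i \<in> {..<N}. Z i = q}. f i (Z i))
          = (\<Sum>i\<in>{i \<in> {..<N}. Z i = q}. c q * (Y i q - Ybar N Y q) / real (Nq q))"
        by (rule sum.cong) (auto simp: f_def)
      also have "\<dots> = c q * ((\<Sum>i\<in>{i \<in> {..<N}. Z i = q}. Y i q) - real (Nq q) * Ybar N Y q) / real (Nq q)"
        using card by (simp add: sum_subtractf flip: sum_distrib_left sum_divide_distrib)
      also have "\<dots> = c q * ((\<Sum>i\<in>{i \<in> {..<N}. Z i = q}. Y i q) / real (Nq q) - Ybar N Y q)"
        using pos[of q] q by (simp add: field_simps)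
      finally show "(\<Sum>i\<in>{i \<in> {..<N}. Z i = q}. f i (Z i))
        = c q * ((\<Sum>i\<in>{i \<in> {..<N}. Z i = q}. Y i q) / real (Nq q) - Ybar N Y q)" .
    qed
    finally show ?thesis by simp
  qed
  \<comment> \<open>Rewriting the statistic as a sum over units uses that group q has exactly
    \<open>Nq q\<close> units. This is guaranteed on the support only, so the events are compared up
    to null sets.\<close>
  have ae: "measure_pmf.prob (CR N Q Nq) {Z. ?g Z \<le> t} = measure_pmf.prob (CR N Q Nq) {Z. (\<Sum>i<N. f i (Z i)) \<le> t}"
  proof (rule measure_prob_cong_0)
    have set: "set_pmf (CR N Q Nq) = assignments N Q Nq"
      unfolding CR_def using L by (intro set_pmf_of_set finite_assignments) auto
    show "pmf (CR N Q Nq) Z = 0" if "Z \<in> {Z. ?g Z \<le> t} - {Z. (\<Sum>i<N. f i (Z i)) \<le> t}" for Z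
      using that g[of Z] by (auto simp: pmf_eq_0_set_pmf set)
    show "pmf (CR N Q Nq) Z = 0" if "Z \<in> {Z. (\<Sum>i<N. f i (Z i)) \<le> t} - {Z. ?g Z \<le> t}" for Z
      using that g[of Z] by (auto simp: pmf_eq_0_set_pmf set)
  qed
  have "\<bar>real (card {\<pi> \<in> perms N. psum N a \<pi> \<le> t}) / fact N - Phi t\<bar> \<le> 12 * (mills 0 + 3) * \<delta>"
  proof (rule combinatorial_berry_esseen[OF N])
    have "(\<Sum>i<N. a i j) = 0" for j
      unfolding a_def f_def using sum_centered[of N Y "L j"] N
      by (simp flip: sum_distrib_left sum_divide_distrib)
    then show "(\<Sum>i<N. \<Sum>j<N. a i j) = 0" by (subst sum.swap) simp
    show "\<bar>a i j\<bar> \<le> \<delta>" if "i < N" "j < N" for i j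
      using bd[OF that(1) assignments_less[OF L that(2)]] by (simp add: a_def f_def)
    show "swap_var N a = 1"
      unfolding a_def f_def using swap_var_levels[OF N L pos, of c Y] var by simp
  qed
  moreover have "{\<pi> \<in> perms N. restrict (L \<circ> \<pi>) {..<N} \<in> {Z. (\<Sum>i<N. f i (Z i)) \<le> t}}
      = {\<pi> \<in> perms N. psum N a \<pi> \<le> t}"
    by (simp add: psum_def a_def)
  ultimately have "\<bar>measure_pmf.prob (CR N Q Nq) {Z. (\<Sum>i<N. f i (Z i)) \<le> t} - Phi t\<bar> \<le> 12 * (mills 0 + 3) * \<delta>"
    unfolding CR_prob_eq_perms[OF L] by simp
  then show ?thesis unfolding ae .
qed

section \<open>Real symmetric matrices\<close>

text \<open>Over the complex numbers an eigenvector v with eigenvalue z exists. The number z |v|^2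
  is the Hermitian form of the matrix at v, which symmetry makes self-conjugate; so z is real and is
  a root of the real characteristic polynomial.\<close>

lemma real_symmetric_eigenvalue_exists:
  fixes A :: "real mat"
  assumes A: "A \<in> carrier_mat n n" and sym: "transpose_mat A = A" and n: "0 < n"
  shows "\<exists>e. eigenvalue A e"
proof -
  define C where "C = map_mat complex_of_real A"
  have C: "C \<in> carrier_mat n n" using A by (simp add: C_def)
  have "degree (char_poly C) = n" using degree_monic_char_poly[OF C] by simp
  then have "\<not> constant (poly (char_poly C))" using n by (simp add: constant_degree)
  then obtain z where z: "poly (char_poly C) z = 0"
    using fundamental_theorem_of_algebra by blast
  then obtain v where v: "v \<in> carrier_vec n" "v \<noteq> 0\<^sub>v n" "C *\<^sub>v v = z \<cdot>\<^sub>v v"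
    using eigenvalue_root_char_poly[OF C] C unfolding eigenvalue_def eigenvector_def by auto
  define s where "s = (\<Sum>i<n. \<Sum>j<n. cnj (v $ i) * complex_of_real (A $$ (i, j)) * v $ j)"
  define m where "m = (\<Sum>i<n. cnj (v $ i) * v $ i)"
  have Aij: "A $$ (i, j) = A $$ (j, i)" if "i < n" "j < n" for i j
    using arg_cong[OF sym, of "\<lambda>M. M $$ (i, j)"] that A by simp
  have "s = (\<Sum>i<n. cnj (v $ i) * (C *\<^sub>v v) $ i)"
    unfolding s_def using A v(1)
    by (intro sum.cong refl)
       (auto simp: C_def scalar_prod_def sum_distrib_left mult.assoc lessThan_atLeast0)
  also have "\<dots> = z * m"
    unfolding v(3) m_def using v(1) by (auto simp: sum_distrib_left mult_ac)
  finally have s: "s = z * m" .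
  have "cnj s = (\<Sum>i<n. \<Sum>j<n. v $ i * complex_of_real (A $$ (i, j)) * cnj (v $ j))"
    by (simp add: s_def)
  also have "\<dots> = (\<Sum>j<n. \<Sum>i<n. v $ i * complex_of_real (A $$ (i, j)) * cnj (v $ j))"
    by (rule sum.swap)
  also have "\<dots> = s"
    unfolding s_def by (intro sum.cong refl) (auto simp: Aij)
  finally have cs: "cnj s = s" .
  have cm: "cnj m = m" by (simp add: m_def mult.commute)
  have m': "m = complex_of_real (\<Sum>i<n. (cmod (v $ i))\<^sup>2)"
    unfolding m_def of_real_sum by (intro sum.cong refl) (simp only: complex_norm_square mult.commute)
  obtain k where k: "k < n" "v $ k \<noteq> 0" using v(1,2) by (metis carrier_vecD eq_vecI index_zero_vec(1) zero_carrier_vec)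
  have "0 < (\<Sum>i<n. (cmod (v $ i))\<^sup>2)"
    by (rule sum_pos2[of _ k]) (use k in auto)
  then have m0: "m \<noteq> 0" unfolding m' by (simp only: of_real_eq_0_iff)
  have "cnj z * m = z * m" using cs cm unfolding s by simp
  then have "cnj z = z" using m0 by simp
  then obtain x where x: "z = complex_of_real x" by (metis Reals_cases Reals_cnj_iff)
  have "char_poly C = map_poly complex_of_real (char_poly A)"
    unfolding C_def by (rule of_real_hom.char_poly_hom[OF A])
  then have "complex_of_real (poly (char_poly A) x) = 0"
    using z unfolding x by simp
  then have "poly (char_poly A) x = 0" by simp
  then show ?thesis using eigenvalue_root_char_poly[OF A] by blast
qed

lemma real_scalar_prod_self_pos:
  fixes v :: "real vec"
  assumes "v \<in> carrier_vec n" "v \<noteq> 0\<^sub>v n"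
  shows "0 < v \<bullet> v"
proof -
  obtain k where k: "k < n" "v $ k \<noteq> 0" using assms by (metis carrier_vecD eq_vecI index_zero_vec(1) zero_carrier_vec)
  have "0 < (\<Sum>i = 0..<n. v $ i * v $ i)"
    by (rule sum_pos2[of _ k]) (use k in \<open>auto simp: zero_less_mult_iff\<close>)
  then show ?thesis using assms(1) by (simp add: scalar_prod_def)
qed

text \<open>Extend v to a basis and orthogonalise: Gram-Schmidt keeps its first vector, so after
  normalisation the first column is a multiple of v.\<close>

lemma exists_orthogonal_mat_first_col:
  fixes v :: "real vec"
  assumes v: "v \<in> carrier_vec n" "v \<noteq> 0\<^sub>v n" and n: "0 < n"
  obtains U c where "U \<in> carrier_mat n n" "transpose_mat U * U = 1\<^sub>m n" "col U 0 = c \<cdot>\<^sub>v v"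
proof -
  interpret cof_vec_space n "TYPE(real)" .
  define b where "b = basis_completion v"
  define ws where "ws = gram_schmidt n b"
  note bc = basis_completion[OF v, folded b_def]
  obtain vs where bv: "b = v # vs" using bc(6,7) n by (cases b) auto
  note gs = gram_schmidt_result[OF bc(2,4,5) ws_def]
  have len: "length ws = n" using gs(4) bc(6) by simp
  have hdws: "ws ! 0 = v"
    using gram_schmidt_hd[OF v(1), of vs] len n unfolding ws_def bv by (metis hd_conv_nth length_greater_0_conv)
  have wsc: "ws ! i \<in> carrier_vec n" if "i < n" for i using gs(3) len that by (auto simp: subset_iff)
  have orth: "(ws ! i \<bullet> ws ! j = 0) = (i \<noteq> j)" if "i < n" "j < n" for i j
    using corthogonalD[OF gs(2), of i j] that len by simp
  define r where "r = (\<lambda>i. 1 / sqrt (ws ! i \<bullet> ws ! i))"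
  define U where "U = mat_of_cols n (map (\<lambda>i. r i \<cdot>\<^sub>v ws ! i) [0..<n])"
  have U: "U \<in> carrier_mat n n" by (auto simp: U_def)
  have colU: "col U i = r i \<cdot>\<^sub>v ws ! i" if "i < n" for i
    unfolding U_def using that wsc[OF that] by (subst col_mat_of_cols) auto
  have "transpose_mat U * U = 1\<^sub>m n"
  proof (rule eq_matI)
    fix i j assume "i < dim_row (1\<^sub>m n)" "j < dim_col (1\<^sub>m n)"
    then have ij: "i < n" "j < n" by auto
    have "(transpose_mat U * U) $$ (i, j) = col U i \<bullet> col U j" using U ij by simp
    also have "\<dots> = r i * (r j * (ws ! i \<bullet> ws ! j))"
      using wsc[OF ij(1)] wsc[OF ij(2)] by (simp add: colU[OF ij(1)] colU[OF ij(2)])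
    also have "\<dots> = 1\<^sub>m n $$ (i, j)"
    proof (cases "i = j")
      case True
      have "ws ! i \<noteq> 0\<^sub>v n" using orth[of i i] wsc[of i] ij by auto
      then have "0 < ws ! i \<bullet> ws ! i" using real_scalar_prod_self_pos wsc ij by blast
      then have "r i * r i * (ws ! i \<bullet> ws ! i) = 1"
        unfolding r_def by (simp add: field_simps)
      then show ?thesis using True ij by simp
    next
      case False
      then show ?thesis using orth[of i j] ij by simp
    qed
    finally show "(transpose_mat U * U) $$ (i, j) = 1\<^sub>m n $$ (i, j)" .
  qed (use U in auto)
  then show ?thesis using that[OF U, of "r 0"] colU[OF n] hdws by simp
qed

lemma four_block_diag:
  "four_block_mat (mat 1 1 (\<lambda>_. e)) (0\<^sub>m 1 m) (0\<^sub>m m 1) (mat_diag m d)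
     = mat_diag (Suc m) (\<lambda>i. case i of 0 \<Rightarrow> e | Suc k \<Rightarrow> (d k :: real))"
  by (rule eq_matI) (auto simp: mat_diag_def split: nat.splits)

text \<open>Deflation: in an orthonormal basis that starts with an eigenvector, the first column of
  the matrix is e followed by zeros, and symmetry clears the first row as well. The remaining block
  is symmetric of size m and falls to the induction hypothesis.\<close>

theorem real_spectral_theorem:
  fixes A :: "real mat"
  assumes "A \<in> carrier_mat n n" "transpose_mat A = A"
  shows "\<exists>U d. U \<in> carrier_mat n n \<and> transpose_mat U * U = 1\<^sub>m n \<and>
    A = U * mat_diag n d * transpose_mat U"
  using assms
proof (induction n arbitrary: A)
  case 0
  then show ?case by (intro exI[of _ "1\<^sub>m 0"] exI[of _ "\<lambda>_. 0"] conjI) (auto intro!: eq_matI simp: mat_diag_def)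
next
  case (Suc m)
  let ?n = "Suc m"
  note A = Suc.prems(1) and sym = Suc.prems(2)
  from real_symmetric_eigenvalue_exists[OF A sym] obtain e v where
    v: "v \<in> carrier_vec ?n" "v \<noteq> 0\<^sub>v ?n" "A *\<^sub>v v = e \<cdot>\<^sub>v v"
    using A by (auto simp: eigenvalue_def eigenvector_def)
  obtain U c where U: "U \<in> carrier_mat ?n ?n" "transpose_mat U * U = 1\<^sub>m ?n" "col U 0 = c \<cdot>\<^sub>v v"
    using exists_orthogonal_mat_first_col[OF v(1,2)] by auto
  have UT: "transpose_mat U \<in> carrier_mat ?n ?n" using U by simp
  have UUT: "U * transpose_mat U = 1\<^sub>m ?n"
    by (rule mat_mult_left_right_inverse[OF UT U(1) U(2)])
  define B where "B = transpose_mat U * A * U"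
  have B: "B \<in> carrier_mat ?n ?n" using U A by (simp add: B_def)
  have symB: "transpose_mat B = B"
  proof -
    have "transpose_mat B = transpose_mat U * (transpose_mat A * U)"
      unfolding B_def using U A UT by (simp add: transpose_mult[of _ ?n ?n _ ?n])
    also have "\<dots> = B" unfolding sym B_def using U A UT by (simp add: assoc_mult_mat[of _ ?n ?n _ ?n _ ?n])
    finally show ?thesis .
  qed
  have AB: "A = U * B * transpose_mat U"
  proof -
    have "U * B * transpose_mat U = (U * transpose_mat U) * A * (U * transpose_mat U)"
      unfolding B_def using U(1) A UT by (simp add: assoc_mult_mat[of _ ?n ?n _ ?n _ ?n])
    then show ?thesis using A by (simp add: UUT)
  qed
  have B0: "B $$ (i, 0) = (if i = 0 then e else 0)" if "i < ?n" for i
  proof -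
    have "A *\<^sub>v col U 0 = e \<cdot>\<^sub>v col U 0"
      unfolding U(3) using A v by (simp add: mult_mat_vec[OF A v(1)] smult_smult_assoc mult.commute)
    then have "col (A * U) 0 = e \<cdot>\<^sub>v col U 0" using col_mult2[OF A U(1), of 0] by (metis zero_less_Suc)
    then have "B $$ (i, 0) = col U i \<bullet> (e \<cdot>\<^sub>v col U 0)"
      unfolding B_def using U(1) A UT that by (simp add: assoc_mult_mat[of _ ?n ?n _ ?n _ ?n])
    also have "\<dots> = e * (transpose_mat U * U) $$ (i, 0)" using U(1) that by simp
    finally show ?thesis unfolding U(2) using that by simp
  qed
  have B0': "B $$ (0, i) = (if i = 0 then e else 0)" if "i < ?n" for i
    using arg_cong[OF symB, of "\<lambda>M. M $$ (i, 0)"] B B0[OF that] that by simp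
  define D where "D = mat m m (\<lambda>(i, j). B $$ (Suc i, Suc j))"
  have D: "D \<in> carrier_mat m m" by (simp add: D_def)
  have "transpose_mat D = D"
  proof (rule eq_matI)
    fix i j assume "i < dim_row D" "j < dim_col D"
    then show "transpose_mat D $$ (i, j) = D $$ (i, j)"
      using arg_cong[OF symB, of "\<lambda>M. M $$ (Suc i, Suc j)"] B by (simp add: D_def)
  qed (auto simp: D_def)
  from Suc.IH[OF D this] obtain P d where P: "P \<in> carrier_mat m m" "transpose_mat P * P = 1\<^sub>m m"
    "D = P * mat_diag m d * transpose_mat P" by blast
  let ?E = "mat 1 1 (\<lambda>_. e)"
  define R where "R = four_block_mat (1\<^sub>m 1) (0\<^sub>m 1 m) (0\<^sub>m m 1) P"
  have R: "R \<in> carrier_mat ?n ?n" using four_block_carrier_mat[of "1\<^sub>m 1" 1 1 P m m] P(1) by (simp add: R_def)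
  have RT: "transpose_mat R = four_block_mat (1\<^sub>m 1) (0\<^sub>m 1 m) (0\<^sub>m m 1) (transpose_mat P)"
    unfolding R_def using P(1) by (subst transpose_four_block_mat[of _ 1 1 _ m _ m]) auto
  define d' where "d' = (\<lambda>i. case i of 0 \<Rightarrow> e | Suc k \<Rightarrow> d k)"
  have "B = four_block_mat ?E (0\<^sub>m 1 m) (0\<^sub>m m 1) D"
  proof (rule eq_matI)
    fix i j assume "i < dim_row (four_block_mat ?E (0\<^sub>m 1 m) (0\<^sub>m m 1) D)"
      "j < dim_col (four_block_mat ?E (0\<^sub>m 1 m) (0\<^sub>m m 1) D)"
    then have ij: "i < ?n" "j < ?n" by (auto simp: D_def)
    then show "B $$ (i, j) = four_block_mat ?E (0\<^sub>m 1 m) (0\<^sub>m m 1) D $$ (i, j)"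
      using B0[of i] B0'[of j] by (cases i; cases j) (auto simp: D_def)
  qed (use B in \<open>auto simp: D_def\<close>)
  also have "\<dots> = R * mat_diag ?n d' * transpose_mat R"
    unfolding RT unfolding R_def d'_def four_block_diag[symmetric] P(3) using P(1) mat_diag_dim[of m d]
    by (simp add: mult_four_block_mat[of _ 1 1 _ m _ m _ _ 1 _ m] del: mat_diag_dim)
  finally have BR: "B = R * mat_diag ?n d' * transpose_mat R" .
  have RR: "transpose_mat R * R = 1\<^sub>m ?n"
    unfolding RT unfolding R_def using P(1)
    by (simp add: mult_four_block_mat[of _ 1 1 _ m _ m _ _ 1 _ m] P(2))
  have RTc: "transpose_mat R \<in> carrier_mat ?n ?n" using R by simp
  have T: "transpose_mat (U * R) = transpose_mat R * transpose_mat U"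
    using U(1) R by (rule transpose_mult)
  have dd: "mat_diag ?n d' \<in> carrier_mat ?n ?n" by simp
  show ?case
  proof (intro exI conjI)
    show "U * R \<in> carrier_mat ?n ?n" using U(1) R by simp
    have "transpose_mat (U * R) * (U * R) = transpose_mat R * ((transpose_mat U * U) * R)"
      unfolding T using U(1) R UT RTc by (simp add: assoc_mult_mat[of _ ?n ?n _ ?n _ ?n])
    then show "transpose_mat (U * R) * (U * R) = 1\<^sub>m ?n" using R RR by (simp add: U(2))
    show "A = U * R * mat_diag ?n d' * transpose_mat (U * R)"
      unfolding T by (subst AB, subst BR) (use U(1) R UT RTc dd in
        \<open>simp add: assoc_mult_mat[of _ ?n ?n _ ?n _ ?n] del: mat_diag_dim\<close>)
  qed
qed

section \<open>Quadratic forms, positive definiteness and the inverse square root\<close>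

lemma quadratic_form_diag:
  fixes x :: "real vec"
  assumes U: "U \<in> carrier_mat n n" and x: "x \<in> carrier_vec n"
  shows "x \<bullet> ((U * mat_diag n d * transpose_mat U) *\<^sub>v x) = (\<Sum>i<n. d i * ((transpose_mat U *\<^sub>v x) $ i)\<^sup>2)"
proof -
  let ?y = "transpose_mat U *\<^sub>v x"
  have y: "?y \<in> carrier_vec n" using U x by simp
  have D: "mat_diag n d \<in> carrier_mat n n" by simp
  have UT: "transpose_mat U \<in> carrier_mat n n" using U by simp
  have "(U * mat_diag n d * transpose_mat U) *\<^sub>v x = U *\<^sub>v (mat_diag n d *\<^sub>v ?y)"
    using U D UT x y by (simp add: assoc_mult_mat_vec[of _ n n _ n])
  then have "x \<bullet> ((U * mat_diag n d * transpose_mat U) *\<^sub>v x) = ?y \<bullet> (mat_diag n d *\<^sub>v ?y)"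
    using transpose_vec_mult_scalar[OF U, of "mat_diag n d *\<^sub>v ?y" x] x D y by simp
  also have "mat_diag n d *\<^sub>v ?y = vec n (\<lambda>i. d i * ?y $ i)"
  proof (rule eq_vecI)
    fix i assume "i < dim_vec (vec n (\<lambda>i. d i * ?y $ i))"
    then have i: "i < n" by simp
    have "(mat_diag n d *\<^sub>v ?y) $ i = (\<Sum>j = 0..<n. (if i = j then d j else 0) * ?y $ j)"
      using i y U by (simp add: mat_diag_def scalar_prod_def)
    also have "\<dots> = (\<Sum>j = 0..<n. if j = i then d i * ?y $ i else 0)"
      by (rule sum.cong) auto
    also have "\<dots> = d i * ?y $ i" using i by simp
    finally show "(mat_diag n d *\<^sub>v ?y) $ i = vec n (\<lambda>i. d i * ?y $ i) $ i" using i by simp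
  qed (simp_all add: mat_diag_def)
  also have "?y \<bullet> vec n (\<lambda>i. d i * ?y $ i) = (\<Sum>i<n. d i * (?y $ i)\<^sup>2)"
    unfolding scalar_prod_def using y
    by (auto simp: power2_eq_square lessThan_atLeast0 intro!: sum.cong)
  finally show ?thesis .
qed

lemma scalar_prod_self_orthogonal:
  fixes x :: "real vec"
  assumes U: "U \<in> carrier_mat n n" "transpose_mat U * U = 1\<^sub>m n" and x: "x \<in> carrier_vec n"
  shows "x \<bullet> x = (\<Sum>i<n. ((transpose_mat U *\<^sub>v x) $ i)\<^sup>2)"
proof -
  have UT: "transpose_mat U \<in> carrier_mat n n" using U by simp
  have UUT: "U * transpose_mat U = 1\<^sub>m n"
    by (rule mat_mult_left_right_inverse[OF UT U(1) U(2)])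
  have "x \<bullet> ((U * mat_diag n (\<lambda>_. 1) * transpose_mat U) *\<^sub>v x) = x \<bullet> x"
    using U x by (simp add: UUT)
  then show ?thesis using quadratic_form_diag[OF U(1) x, of "\<lambda>_. 1"] by simp
qed

lemma eigenvector_col_orthogonal:
  fixes U :: "real mat"
  assumes U: "U \<in> carrier_mat n n" "transpose_mat U * U = 1\<^sub>m n" and k: "k < n"
    and A: "A = U * mat_diag n d * transpose_mat U"
  shows "eigenvector A (col U k) (d k)" "col U k \<bullet> (A *\<^sub>v col U k) = d k" "col U k \<noteq> 0\<^sub>v n"
proof -
  have UT: "transpose_mat U \<in> carrier_mat n n" using U by simp
  have D: "mat_diag n d \<in> carrier_mat n n" by simp
  have Ac: "A \<in> carrier_mat n n"
    unfolding A by (rule mult_carrier_mat[OF mult_carrier_mat[OF U(1) D] UT])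
  have c: "col U k \<in> carrier_vec n" using U k by simp
  have one: "col U k \<bullet> col U k = 1"
    using arg_cong[OF U(2), of "\<lambda>M. M $$ (k, k)"] U(1) k by simp
  then show nz: "col U k \<noteq> 0\<^sub>v n" using c by auto
  have "A * U = U * mat_diag n d"
  proof -
    have "A * U = U * mat_diag n d * (transpose_mat U * U)"
      unfolding A using U(1) UT D by (simp add: assoc_mult_mat[of _ n n _ n _ n] del: mat_diag_dim)
    also have "\<dots> = U * mat_diag n d" unfolding U(2) by (rule right_mult_one_mat[OF mult_carrier_mat[OF U(1) D]])
    finally show ?thesis .
  qed
  then have "A *\<^sub>v col U k = col (U * mat_diag n d) k"
    using col_mult2[OF Ac U(1) k] by simp
  also have "\<dots> = d k \<cdot>\<^sub>v col U k"
    using U(1) k by (intro eq_vecI) (auto simp: mat_diag_mult_right[OF U(1)])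
  finally have ev: "A *\<^sub>v col U k = d k \<cdot>\<^sub>v col U k" .
  then show "eigenvector A (col U k) (d k)"
    unfolding eigenvector_def using c nz Ac by simp
  show "col U k \<bullet> (A *\<^sub>v col U k) = d k" unfolding ev using c one by simp
qed

text \<open>Both squares are inverse to A, so W W = X X. If v is an eigenvector of W - X with
  eigenvalue d, then d times v \<bullet> (W v + X v) equals |W v|^2 - |X v|^2 = 0, and the second
  factor is positive. All eigenvalues of the symmetric matrix W - X are thus 0.\<close>

lemma inv_sqrt_mat_unique:
  fixes A :: "real mat"
  assumes A: "A \<in> carrier_mat n n"
    and W: "W \<in> carrier_mat n n" "transpose_mat W = W" "pos_def_mat n W" "W * W * A = 1\<^sub>m n"
    and X: "X \<in> carrier_mat n n" "transpose_mat X = X" "pos_def_mat n X" "X * X * A = 1\<^sub>m n"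
  shows "W = X"
proof -
  have WW: "W * W \<in> carrier_mat n n" and XX: "X * X \<in> carrier_mat n n" using W X by auto
  have AX: "A * (X * X) = 1\<^sub>m n" by (rule mat_mult_left_right_inverse[OF XX A X(4)])
  have "W * W = W * W * (A * (X * X))" unfolding AX by (rule right_mult_one_mat[OF WW, symmetric])
  also have "\<dots> = W * W * A * (X * X)" using WW A XX by (simp add: assoc_mult_mat[of _ n n _ n _ n])
  also have "\<dots> = X * X" unfolding W(4) by (rule left_mult_one_mat[OF XX])
  finally have eq: "W * W = X * X" .
  define M where "M = W - X"
  have M: "M \<in> carrier_mat n n" unfolding M_def by (rule minus_carrier_mat[OF X(1)])
  have "transpose_mat M = M" unfolding M_def using W X by (simp add: transpose_minus)
  from real_spectral_theorem[OF M this] obtain U d where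
    U: "U \<in> carrier_mat n n" "transpose_mat U * U = 1\<^sub>m n" "M = U * mat_diag n d * transpose_mat U" by blast
  have d0: "d k = 0" if k: "k < n" for k
  proof -
    let ?v = "col U k"
    have v: "?v \<in> carrier_vec n" using U k by simp
    note ev = eigenvector_col_orthogonal[OF U(1,2) k U(3)]
    have Mv: "W *\<^sub>v ?v - X *\<^sub>v ?v = d k \<cdot>\<^sub>v ?v"
      using ev(1) W(1) X(1) v unfolding eigenvector_def M_def by (simp add: minus_mult_distrib_mat_vec)
    have Wv: "W *\<^sub>v ?v \<in> carrier_vec n" and Xv: "X *\<^sub>v ?v \<in> carrier_vec n" using W X v by auto
    have sq: "(Y *\<^sub>v ?v) \<bullet> (Y *\<^sub>v ?v) = ?v \<bullet> ((Y * Y) *\<^sub>v ?v)"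
      if "Y \<in> carrier_mat n n" "transpose_mat Y = Y" for Y
      using transpose_vec_mult_scalar[OF that(1), of "Y *\<^sub>v ?v" ?v] that v
      by (simp add: assoc_mult_mat_vec[of _ n n _ n])
    have "(W *\<^sub>v ?v - X *\<^sub>v ?v) \<bullet> (W *\<^sub>v ?v + X *\<^sub>v ?v)
        = (W *\<^sub>v ?v) \<bullet> (W *\<^sub>v ?v) - (X *\<^sub>v ?v) \<bullet> (X *\<^sub>v ?v)"
      using Wv Xv comm_scalar_prod[OF Wv Xv]
      by (simp add: minus_scalar_prod_distrib[of _ n] scalar_prod_add_distrib[of _ n])
    also have "\<dots> = 0" using sq[OF W(1,2)] sq[OF X(1,2)] eq by simp
    finally have "d k * (?v \<bullet> (W *\<^sub>v ?v + X *\<^sub>v ?v)) = 0"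
      unfolding Mv using v Wv Xv by simp
    moreover have "?v \<bullet> (W *\<^sub>v ?v + X *\<^sub>v ?v) > 0"
      using W(3) X(3) ev(3) v Wv Xv unfolding pos_def_mat_def
      by (simp add: scalar_prod_add_distrib[of _ n] add_pos_pos)
    ultimately show ?thesis by simp
  qed
  have "mat_diag n d = 0\<^sub>m n n" by (rule eq_matI) (auto simp: mat_diag_def d0)
  then have M0: "M = 0\<^sub>m n n" using U by simp
  have "W = M + X" unfolding M_def using W X by (intro eq_matI) auto
  then show ?thesis using M0 X by simp
qed

lemma pos_def_mat_diag:
  fixes U :: "real mat"
  assumes U: "U \<in> carrier_mat n n" "transpose_mat U * U = 1\<^sub>m n" and d: "\<And>k. k < n \<Longrightarrow> 0 < d k"
  shows "pos_def_mat n (U * mat_diag n d * transpose_mat U)"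
  unfolding pos_def_mat_def
proof (intro ballI impI)
  fix x :: "real vec" assume x: "x \<in> carrier_vec n" "x \<noteq> 0\<^sub>v n"
  have "0 < (\<Sum>i<n. ((transpose_mat U *\<^sub>v x) $ i)\<^sup>2)"
    using scalar_prod_self_orthogonal[OF U x(1)] real_scalar_prod_self_pos[OF x] by simp
  then obtain k where k: "k < n" "(transpose_mat U *\<^sub>v x) $ k \<noteq> 0"
    by (metis (no_types, lifting) lessThan_iff less_irrefl power_zero_numeral sum.neutral)
  have "0 < (\<Sum>i<n. d i * ((transpose_mat U *\<^sub>v x) $ i)\<^sup>2)"
    by (rule sum_pos2[of _ k]) (use k d in \<open>auto simp: less_imp_le\<close>)
  then show "x \<bullet> ((U * mat_diag n d * transpose_mat U) *\<^sub>v x) > 0"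
    unfolding quadratic_form_diag[OF U(1) x(1)] .
qed

text \<open>A zero eigenvalue would put an eigenvector into the kernel, which invertibility
  excludes.\<close>

lemma pos_def_mat_of_invertible:
  fixes A :: "real mat"
  assumes A: "A \<in> carrier_mat n n" "transpose_mat A = A" "invertible_mat A"
    and psd: "\<And>x. x \<in> carrier_vec n \<Longrightarrow> 0 \<le> x \<bullet> (A *\<^sub>v x)"
  shows "pos_def_mat n A"
proof -
  obtain U d where U: "U \<in> carrier_mat n n" "transpose_mat U * U = 1\<^sub>m n"
    "A = U * mat_diag n d * transpose_mat U" using real_spectral_theorem[OF A(1,2)] by blast
  obtain B where B: "B * A = 1\<^sub>m (dim_row B)" "A * B = 1\<^sub>m n"
    using A(1,3) by (auto simp: invertible_mat_def inverts_mat_def)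
  \<comment> \<open>\<open>inverts_mat\<close> leaves the size of B open; counting columns in the
    two products determines it.\<close>
  have Bc: "B \<in> carrier_mat n n"
    using arg_cong[OF B(1), of dim_col] arg_cong[OF B(2), of dim_col] A(1) by (intro carrier_matI) auto
  have BA: "B * A = 1\<^sub>m n" using B(1) Bc by simp
  have "0 < d k" if k: "k < n" for k
  proof -
    note ev = eigenvector_col_orthogonal[OF U(1,2) k U(3)]
    have c: "col U k \<in> carrier_vec n" using U k by simp
    have "0 \<le> d k" using psd[OF c] ev(2) by simp
    moreover have "d k \<noteq> 0"
    proof
      assume "d k = 0"
      then have "A *\<^sub>v col U k = 0 \<cdot>\<^sub>v col U k" using ev(1) by (simp add: eigenvector_def)
      also have "\<dots> = 0\<^sub>v n" by (rule eq_vecI) (use U(1) k in auto)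
      finally have "A *\<^sub>v col U k = 0\<^sub>v n" .
      moreover have "B *\<^sub>v 0\<^sub>v n = 0\<^sub>v n" by (rule eq_vecI) (use Bc in auto)
      ultimately have "(B * A) *\<^sub>v col U k = 0\<^sub>v n"
        using Bc A(1) c by (simp add: assoc_mult_mat_vec[of _ n n _ n])
      then show False using ev(3) c unfolding BA by simp
    qed
    ultimately show ?thesis by simp
  qed
  then show ?thesis unfolding U(3) by (intro pos_def_mat_diag U)
qed

lemma pos_def_spectral:
  fixes A :: "real mat"
  assumes A: "A \<in> carrier_mat n n" "transpose_mat A = A" and pd: "pos_def_mat n A"
  obtains U d where "U \<in> carrier_mat n n" "transpose_mat U * U = 1\<^sub>m n"
    "A = U * mat_diag n d * transpose_mat U" "\<And>k. k < n \<Longrightarrow> 0 < d k"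
proof -
  obtain U d where U: "U \<in> carrier_mat n n" "transpose_mat U * U = 1\<^sub>m n"
    "A = U * mat_diag n d * transpose_mat U" using real_spectral_theorem[OF A] by blast
  have "0 < d k" if k: "k < n" for k
    using eigenvector_col_orthogonal[OF U(1,2) k U(3)] pd U(1) k
    unfolding pos_def_mat_def by (metis col_carrier_vec carrier_matD(2))
  then show ?thesis using that U by blast
qed

text \<open>The witness has eigenvalues 1 / sqrt (d k) in the spectral basis of A;
  \<open>inv_sqrt_mat_unique\<close> identifies it with the definite description.\<close>

lemma inv_sqrt_mat_works:
  fixes A :: "real mat"
  assumes A: "A \<in> carrier_mat n n" "transpose_mat A = A" and pd: "pos_def_mat n A"
  shows "inv_sqrt_mat A \<in> carrier_mat n n" "transpose_mat (inv_sqrt_mat A) = inv_sqrt_mat A"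
    "inv_sqrt_mat A * A * inv_sqrt_mat A = 1\<^sub>m n"
proof -
  obtain U d where U: "U \<in> carrier_mat n n" "transpose_mat U * U = 1\<^sub>m n"
    "A = U * mat_diag n d * transpose_mat U" and d: "\<And>k. k < n \<Longrightarrow> 0 < d k"
    using pos_def_spectral[OF A pd] by blast
  have UT: "transpose_mat U \<in> carrier_mat n n" using U by simp
  have UUT: "U * transpose_mat U = 1\<^sub>m n"
    by (rule mat_mult_left_right_inverse[OF UT U(1) U(2)])
  define s where "s = (\<lambda>k. 1 / sqrt (d k))"
  define W where "W = U * mat_diag n s * transpose_mat U"
  have D: "mat_diag n f \<in> carrier_mat n n" for f :: "nat \<Rightarrow> real" by simp
  have prod: "U * mat_diag n f * transpose_mat U * (U * mat_diag n g * transpose_mat U)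
      = U * mat_diag n (\<lambda>k. f k * g k) * transpose_mat U" for f g :: "nat \<Rightarrow> real"
  proof -
    have "U * mat_diag n f * transpose_mat U * (U * mat_diag n g * transpose_mat U)
      = U * mat_diag n f * ((transpose_mat U * U) * (mat_diag n g * transpose_mat U))"
      using U(1) UT D[of f] D[of g] by (simp add: assoc_mult_mat[of _ n n _ n _ n] del: mat_diag_dim)
    also have "\<dots> = U * (mat_diag n f * mat_diag n g) * transpose_mat U"
      unfolding U(2) using U(1) UT D[of f] D[of g] by (simp add: assoc_mult_mat[of _ n n _ n _ n] del: mat_diag_diag mat_diag_dim)
    finally show ?thesis by simp
  qed
  have W: "W \<in> carrier_mat n n" 
    unfolding W_def by (rule mult_carrier_mat[OF mult_carrier_mat[OF U(1) D] UT])
  have diagT: "transpose_mat (mat_diag n s) = mat_diag n s" by (rule eq_matI) (auto simp: mat_diag_def)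
  have "transpose_mat W = W"
    unfolding W_def using U(1) UT D[of s]
    by (simp add: transpose_mult[of _ n n _ n] diagT assoc_mult_mat[of _ n n _ n _ n] del: mat_diag_dim)
  moreover have "pos_def_mat n W"
    unfolding W_def using d by (intro pos_def_mat_diag[OF U(1,2)]) (simp add: s_def)
  moreover have "W * W * A = 1\<^sub>m n"
  proof -
    have "W * W * A = U * mat_diag n (\<lambda>k. s k * s k * d k) * transpose_mat U"
      unfolding W_def U(3) prod ..
    also have "mat_diag n (\<lambda>k. s k * s k * d k) = 1\<^sub>m n"
    proof (rule eq_matI)
      fix i j assume "i < dim_row (1\<^sub>m n)" "j < dim_col (1\<^sub>m n)"
      then show "mat_diag n (\<lambda>k. s k * s k * d k) $$ (i, j) = 1\<^sub>m n $$ (i, j)"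
        using d[of i] by (auto simp: mat_diag_def s_def)
    qed (auto simp: mat_diag_def)
    finally show ?thesis using U(1) UUT by simp
  qed
  ultimately have ex: "W \<in> carrier_mat n n \<and> transpose_mat W = W \<and> pos_def_mat n W \<and> W * W * A = 1\<^sub>m n"
    using W by simp
  have "inv_sqrt_mat A = W"
    unfolding inv_sqrt_mat_def
  proof (rule the_equality)
    show "W \<in> carrier_mat (dim_row A) (dim_row A) \<and> transpose_mat W = W
      \<and> pos_def_mat (dim_row A) W \<and> W * W * A = 1\<^sub>m (dim_row A)" using ex A by simp
    show "X = W" if "X \<in> carrier_mat (dim_row A) (dim_row A) \<and> transpose_mat X = X
      \<and> pos_def_mat (dim_row A) X \<and> X * X * A = 1\<^sub>m (dim_row A)" for X
      using inv_sqrt_mat_unique[of A n X W] that ex A by simp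
  qed
  \<comment> \<open>W (W A) = 1 makes W A a two-sided inverse of W, so the factors may be
    rotated.\<close>
  moreover have "W * A * W = 1\<^sub>m n"
  proof (rule mat_mult_left_right_inverse)
    show "W * (W * A) = 1\<^sub>m n" using ex A W by (simp add: assoc_mult_mat[of _ n n _ n _ n])
  qed (use W A in auto)
  ultimately show "inv_sqrt_mat A \<in> carrier_mat n n" "transpose_mat (inv_sqrt_mat A) = inv_sqrt_mat A"
    "inv_sqrt_mat A * A * inv_sqrt_mat A = 1\<^sub>m n" using ex by auto
qed

text \<open>The \<open>Min\<close> in \<open>rho_min\<close> is attained: the eigenvalues are roots
  of a nonzero polynomial and, as 0 < n, at least one exists. Expanding x in the spectral basis
  gives the Rayleigh bound.\<close>

lemma rho_min_rayleigh:
  fixes A :: "real mat"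
  assumes A: "A \<in> carrier_mat n n" "transpose_mat A = A" and pd: "pos_def_mat n A" and n: "0 < n"
  shows "0 < rho_min A" "x \<in> carrier_vec n \<Longrightarrow> rho_min A * (x \<bullet> x) \<le> x \<bullet> (A *\<^sub>v x)"
proof -
  obtain U d where U: "U \<in> carrier_mat n n" "transpose_mat U * U = 1\<^sub>m n"
    "A = U * mat_diag n d * transpose_mat U" and d: "\<And>k. k < n \<Longrightarrow> 0 < d k"
    using pos_def_spectral[OF A pd] by blast
  have "degree (char_poly A) = n" using degree_monic_char_poly[OF A(1)] by simp
  then have "char_poly A \<noteq> 0" using n by auto
  then have fin: "finite {k. eigenvalue A k}"
    unfolding eigenvalue_root_char_poly[OF A(1)] by (rule poly_roots_finite)
  have ev: "eigenvalue A (d k)" if "k < n" for k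
    using eigenvector_col_orthogonal(1)[OF U(1,2) that U(3)] by (auto simp: eigenvalue_def)
  have "rho_min A \<in> {k. eigenvalue A k}"
    unfolding rho_min_def using fin ev[OF n] by (intro Min_in) auto
  then obtain v where v: "v \<in> carrier_vec n" "v \<noteq> 0\<^sub>v n" "A *\<^sub>v v = rho_min A \<cdot>\<^sub>v v"
    using A by (auto simp: eigenvalue_def eigenvector_def)
  have "0 < v \<bullet> (A *\<^sub>v v)" using pd v(1,2) unfolding pos_def_mat_def by blast
  then have "0 < rho_min A * (v \<bullet> v)" unfolding v(3) using v(1) by simp
  then show "0 < rho_min A" using real_scalar_prod_self_pos[OF v(1,2)]
    by (simp add: zero_less_mult_iff)
  show "rho_min A * (x \<bullet> x) \<le> x \<bullet> (A *\<^sub>v x)" if x: "x \<in> carrier_vec n"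
  proof -
    have "rho_min A \<le> d k" if "k < n" for k
      unfolding rho_min_def using fin ev[OF that] by (intro Min_le) auto
    then show ?thesis
      unfolding U(3) quadratic_form_diag[OF U(1) x] scalar_prod_self_orthogonal[OF U(1,2) x] sum_distrib_left
      unfolding U(3)[symmetric] by (intro sum_mono mult_right_mono) auto
  qed
qed

section \<open>Linear combinations of the group means\<close>

lemma quadratic_form_sum:
  fixes c :: "real vec"
  assumes "c \<in> carrier_vec n"
  shows "c \<bullet> (mat n n f *\<^sub>v c) = (\<Sum>q<n. \<Sum>r<n. c $ q * f (q, r) * c $ r)"
  using assms
  by (auto simp: scalar_prod_def sum_distrib_left mult.assoc lessThan_atLeast0 intro!: sum.cong)

lemma Dmat_carrier: "Dmat N Q Nq Y \<in> carrier_mat Q Q"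
  by (simp add: Dmat_def)

lemma VY_carrier: "VY N Q Nq Y \<in> carrier_mat Q Q"
  unfolding VY_def by (rule minus_carrier_mat) simp

lemma Scov_sym: "Scov N Y q r = Scov N Y r q"
  by (simp add: Scov_def mult.commute)

lemma Dmat_quadratic_form:
  assumes "c \<in> carrier_vec Q"
  shows "c \<bullet> (Dmat N Q Nq Y *\<^sub>v c) = (\<Sum>q<Q. (c $ q)\<^sup>2 * (Scov N Y q q / real (Nq q)))"
proof -
  have "c \<bullet> (Dmat N Q Nq Y *\<^sub>v c)
      = (\<Sum>q<Q. \<Sum>r<Q. if r = q then (c $ q)\<^sup>2 * (Scov N Y q q / real (Nq q)) else 0)"
    unfolding Dmat_def quadratic_form_sum[OF assms]
    by (intro sum.cong refl) (auto simp: power2_eq_square)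
  then show ?thesis by simp
qed

lemma VY_quadratic_form:
  assumes c: "c \<in> carrier_vec Q"
  shows "c \<bullet> (VY N Q Nq Y *\<^sub>v c) = (\<Sum>q<Q. (c $ q)\<^sup>2 * (Scov N Y q q / real (Nq q)))
    - (\<Sum>q<Q. \<Sum>r<Q. c $ q * c $ r * (Scov N Y q r / real N))"
proof -
  let ?S = "mat Q Q (\<lambda>(q, q'). Scov N Y q q' / real N)"
  have "VY N Q Nq Y *\<^sub>v c = Dmat N Q Nq Y *\<^sub>v c - ?S *\<^sub>v c"
    unfolding VY_def by (rule minus_mult_distrib_mat_vec[OF Dmat_carrier _ c]) simp
  moreover have "Dmat N Q Nq Y *\<^sub>v c \<in> carrier_vec Q" "?S *\<^sub>v c \<in> carrier_vec Q"
    by (rule mult_mat_vec_carrier[OF _ c], simp add: Dmat_carrier)+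
  ultimately have "c \<bullet> (VY N Q Nq Y *\<^sub>v c) = c \<bullet> (Dmat N Q Nq Y *\<^sub>v c) - c \<bullet> (?S *\<^sub>v c)"
    using scalar_prod_minus_distrib[OF c] by metis
  also have "c \<bullet> (?S *\<^sub>v c) = (\<Sum>q<Q. \<Sum>r<Q. c $ q * c $ r * (Scov N Y q r / real N))"
    unfolding quadratic_form_sum[OF c] by (simp add: mult_ac)
  finally show ?thesis unfolding Dmat_quadratic_form[OF c] .
qed

text \<open>For N \<ge> 2 the form is a \<open>swap_var\<close>, hence a normalised sum of squares.
  For N \<le> 1 it is identically zero, so a nonzero value certifies N \<ge> 2.\<close>

lemma VY_quadratic_form_nonneg:
  assumes pos: "\<forall>q<Q. 1 \<le> Nq q" and sum: "(\<Sum>q<Q. Nq q) = N" and c: "c \<in> carrier_vec Q"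
  shows "0 \<le> c \<bullet> (VY N Q Nq Y *\<^sub>v c)" "c \<bullet> (VY N Q Nq Y *\<^sub>v c) \<noteq> 0 \<Longrightarrow> 2 \<le> N"
proof -
  have ge: "0 \<le> c \<bullet> (VY N Q Nq Y *\<^sub>v c)" if N: "2 \<le> N"
  proof -
    obtain L where L: "L \<in> assignments N Q Nq" using exists_assignment[OF sum] N by auto
    have "0 \<le> swap_var N (\<lambda>i j. c $ (L j) * (Y i (L j) - Ybar N Y (L j)) / real (Nq (L j)))"
      unfolding swap_var_def using N by (intro divide_nonneg_nonneg sum_nonneg) auto
    then show ?thesis
      unfolding VY_quadratic_form[OF c] using swap_var_levels[OF N L, of "\<lambda>q. c $ q" Y] pos by simp
  qed
  have eq: "c \<bullet> (VY N Q Nq Y *\<^sub>v c) = 0" if "\<not> 2 \<le> N"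
  proof (cases "N = 0")
    case True
    have "Q = 0"
    proof (rule ccontr)
      assume "Q \<noteq> 0"
      then have "Nq 0 \<le> (\<Sum>q<Q. Nq q)" by (intro member_le_sum) auto
      then show False using pos \<open>Q \<noteq> 0\<close> sum True by simp
    qed
    then show ?thesis unfolding VY_quadratic_form[OF c] by simp
  next
    case False
    with that have "N = 1" by simp
    \<comment> \<open>The divisor N - 1 of \<open>Scov\<close> is 0 here, and division by 0 yields
      0.\<close>
    then have "Scov N Y q r = 0" for q r by (simp add: Scov_def)
    then show ?thesis unfolding VY_quadratic_form[OF c] by simp
  qed
  show "0 \<le> c \<bullet> (VY N Q Nq Y *\<^sub>v c)" using ge eq by (cases "2 \<le> N") auto
  show "c \<bullet> (VY N Q Nq Y *\<^sub>v c) \<noteq> 0 \<Longrightarrow> 2 \<le> N" using eq by blast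
qed

lemma congruence_quadratic_form:
  fixes x :: "real vec"
  assumes F: "F \<in> carrier_mat Q H" and A: "A \<in> carrier_mat Q Q" and x: "x \<in> carrier_vec H"
  shows "x \<bullet> ((transpose_mat F * A * F) *\<^sub>v x) = (F *\<^sub>v x) \<bullet> (A *\<^sub>v (F *\<^sub>v x))"
proof -
  have FT: "transpose_mat F \<in> carrier_mat H Q" using F by simp
  have Fx: "F *\<^sub>v x \<in> carrier_vec Q" using F x by simp
  have AFx: "A *\<^sub>v (F *\<^sub>v x) \<in> carrier_vec Q" using A Fx by simp
  have "(transpose_mat F * A * F) *\<^sub>v x = transpose_mat F *\<^sub>v (A *\<^sub>v (F *\<^sub>v x))"
    using assoc_mult_mat_vec[OF mult_carrier_mat[OF FT A] F x] assoc_mult_mat_vec[OF FT A Fx] by simp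
  also have "x \<bullet> \<dots> = (F *\<^sub>v x) \<bullet> (A *\<^sub>v (F *\<^sub>v x))"
    using transpose_vec_mult_scalar[OF FT AFx x] by simp
  finally show ?thesis .
qed

lemma smult_mat_mult_vec:
  fixes A :: "real mat"
  assumes "A \<in> carrier_mat n m" "x \<in> carrier_vec m"
  shows "(k \<cdot>\<^sub>m A) *\<^sub>v x = k \<cdot>\<^sub>v (A *\<^sub>v x)"
  by (rule eq_vecI) (use assms in \<open>auto simp: scalar_prod_def sum_distrib_left mult.assoc\<close>)

lemma Vgamma_carrier:
  assumes "F \<in> carrier_mat Q H"
  shows "Vgamma N Q Nq Y F \<in> carrier_mat H H"
  unfolding Vgamma_def using assms VY_carrier[of N Q Nq Y] by simp

lemma Vgamma_sym:
  assumes F: "F \<in> carrier_mat Q H"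
  shows "transpose_mat (Vgamma N Q Nq Y F) = Vgamma N Q Nq Y F"
proof -
  have FT: "transpose_mat F \<in> carrier_mat H Q" using F by simp
  note V = VY_carrier[of N Q Nq Y]
  have "transpose_mat (VY N Q Nq Y) = VY N Q Nq Y"
    by (rule eq_matI) (auto simp: VY_def Dmat_def Scov_sym)
  then have "transpose_mat (Vgamma N Q Nq Y F) = transpose_mat F * (VY N Q Nq Y * F)"
    unfolding Vgamma_def
    using transpose_mult[OF mult_carrier_mat[OF FT V] F] transpose_mult[OF FT V] by simp
  also have "\<dots> = Vgamma N Q Nq Y F"
    unfolding Vgamma_def by (rule assoc_mult_mat[OF FT V F, symmetric])
  finally show ?thesis .
qed

lemma Vgamma_pos_def:
  assumes "\<forall>q<Q. 1 \<le> Nq q" "(\<Sum>q<Q. Nq q) = N" and F: "F \<in> carrier_mat Q H"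
    and "invertible_mat (Vgamma N Q Nq Y F)"
  shows "pos_def_mat H (Vgamma N Q Nq Y F)"
proof (rule pos_def_mat_of_invertible[OF Vgamma_carrier[OF F] Vgamma_sym[OF F] assms(4)])
  fix x :: "real vec" assume x: "x \<in> carrier_vec H"
  show "0 \<le> x \<bullet> (Vgamma N Q Nq Y F *\<^sub>v x)"
    unfolding Vgamma_def congruence_quadratic_form[OF F VY_carrier x]
    by (rule VY_quadratic_form_nonneg(1)[OF assms(1,2)]) (use F x in auto)
qed

text \<open>The unit variance is b \<bullet> (W V W b) = b \<bullet> b, with W the inverse square
  root of V. It also yields N \<ge> 2, because for smaller N the quadratic form of \<open>VY\<close>
  is 0.\<close>

lemma berry_esseen_gamma_tilde:
  fixes b :: "real vec"
  assumes pos: "\<forall>q<Q. 1 \<le> Nq q" and sum: "(\<Sum>q<Q. Nq q) = N" and F: "F \<in> carrier_mat Q H"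
    and inv: "invertible_mat (Vgamma N Q Nq Y F)"
    and b: "b \<in> carrier_vec H" "vec_norm2 b = 1"
    and u: "u = inv_sqrt_mat (Vgamma N Q Nq Y F) *\<^sub>v b"
  shows "u \<in> carrier_vec H" "u \<bullet> (Vgamma N Q Nq Y F *\<^sub>v u) = 1" "2 \<le> N"
    "(\<And>i q. i < N \<Longrightarrow> q < Q \<Longrightarrow> \<bar>(F *\<^sub>v u) $ q\<bar> * \<bar>Y i q - Ybar N Y q\<bar> / real (Nq q) \<le> \<delta>) \<Longrightarrow>
     \<bar>measure_pmf.prob (CR N Q Nq) {Z. b \<bullet> gamma_tilde N Q Nq Y F Z \<le> t} - Phi t\<bar>
       \<le> 12 * (mills 0 + 3) * \<delta>"
proof -
  let ?V = "Vgamma N Q Nq Y F" and ?W = "inv_sqrt_mat (Vgamma N Q Nq Y F)"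
  have V: "?V \<in> carrier_mat H H" by (rule Vgamma_carrier[OF F])
  note W = inv_sqrt_mat_works[OF V Vgamma_sym[OF F] Vgamma_pos_def[OF pos sum F inv]]
  show uc: "u \<in> carrier_vec H" using W(1) b(1) by (simp add: u)
  define c where "c = F *\<^sub>v u"
  have c: "c \<in> carrier_vec Q" using F uc by (simp add: c_def)
  have Vu: "?V *\<^sub>v u \<in> carrier_vec H" using V uc by simp
  have bb: "b \<bullet> b = 1" using b(2) by (simp add: vec_norm2_def)
  have "u \<bullet> (?V *\<^sub>v u) = b \<bullet> (?W *\<^sub>v (?V *\<^sub>v u))"
    using transpose_vec_mult_scalar[OF W(1) Vu b(1)] W(2) by (simp add: u)
  also have "?W *\<^sub>v (?V *\<^sub>v u) = (?W * ?V * ?W) *\<^sub>v b"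
    unfolding u using assoc_mult_mat_vec[OF mult_carrier_mat[OF W(1) V] W(1) b(1)]
      assoc_mult_mat_vec[OF W(1) V, of "?W *\<^sub>v b"] W(1) b(1) by simp
  also have "b \<bullet> \<dots> = 1" unfolding W(3) using b(1) bb by simp
  finally show one: "u \<bullet> (?V *\<^sub>v u) = 1" .
  then have cV: "c \<bullet> (VY N Q Nq Y *\<^sub>v c) = 1"
    unfolding Vgamma_def congruence_quadratic_form[OF F VY_carrier uc] c_def .
  then show N: "2 \<le> N" using VY_quadratic_form_nonneg(2)[OF pos sum c, of Y] by simp
  have FT: "transpose_mat F \<in> carrier_mat H Q" using F by simp
  have lin: "b \<bullet> gamma_tilde N Q Nq Y F Z
      = (\<Sum>q<Q. c $ q * ((\<Sum>i\<in>{i \<in> {..<N}. Z i = q}. Y i q) / real (Nq q) - Ybar N Y q))" for Z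
  proof -
    let ?h = "Yhat N Q Nq Y Z" and ?y = "Ybar_vec N Q Y"
    have h: "?h \<in> carrier_vec Q" and y: "?y \<in> carrier_vec Q" by (simp_all add: Yhat_def Ybar_vec_def)
    then have hy: "?h - ?y \<in> carrier_vec Q" by simp
    have "transpose_mat F *\<^sub>v ?h - transpose_mat F *\<^sub>v ?y = transpose_mat F *\<^sub>v (?h - ?y)"
      by (rule mult_minus_distrib_mat_vec[OF FT h y, symmetric])
    then have "b \<bullet> gamma_tilde N Q Nq Y F Z = b \<bullet> (?W *\<^sub>v (transpose_mat F *\<^sub>v (?h - ?y)))"
      by (simp add: gamma_tilde_def)
    also have "\<dots> = u \<bullet> (transpose_mat F *\<^sub>v (?h - ?y))"
      using transpose_vec_mult_scalar[OF W(1) mult_mat_vec_carrier[OF FT hy] b(1)] W(2) by (simp add: u)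
    also have "\<dots> = c \<bullet> (?h - ?y)"
      using transpose_vec_mult_scalar[OF FT hy uc] by (simp add: c_def)
    also have "\<dots> = (\<Sum>q<Q. c $ q * ((\<Sum>i\<in>{i \<in> {..<N}. Z i = q}. Y i q) / real (Nq q) - Ybar N Y q))"
      by (auto simp: scalar_prod_def Yhat_def Ybar_vec_def lessThan_atLeast0 intro!: sum.cong)
    finally show ?thesis .
  qed
  assume bd: "\<And>i q. i < N \<Longrightarrow> q < Q \<Longrightarrow> \<bar>(F *\<^sub>v u) $ q\<bar> * \<bar>Y i q - Ybar N Y q\<bar> / real (Nq q) \<le> \<delta>"
  show "\<bar>measure_pmf.prob (CR N Q Nq) {Z. b \<bullet> gamma_tilde N Q Nq Y F Z \<le> t} - Phi t\<bar>
       \<le> 12 * (mills 0 + 3) * \<delta>"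
    unfolding lin
  proof (rule berry_esseen_CR[OF _ sum N])
    show "(\<Sum>q<Q. (c $ q)\<^sup>2 * (Scov N Y q q / real (Nq q)))
      - (\<Sum>q<Q. \<Sum>q'<Q. c $ q * c $ q' * (Scov N Y q q' / real N)) = 1"
      using cV unfolding VY_quadratic_form[OF c] .
    show "\<bar>c $ q * (Y i q - Ybar N Y q) / real (Nq q)\<bar> \<le> \<delta>" if "i < N" "q < Q" for i q
      using bd[OF that] by (simp add: c_def abs_mult)
  qed (use pos in simp)
qed

section \<open>Bounds on the coefficients of the linear statistic\<close>

lemma abs_le_vec_sup_norm: "q < dim_vec x \<Longrightarrow> \<bar>x $ q\<bar> \<le> vec_sup_norm x"
  unfolding vec_sup_norm_def by (intro Max_ge) auto

lemma abs_le_MN: "i < N \<Longrightarrow> \<bar>Y i q - Ybar N Y q\<bar> \<le> MN N Y q"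
  unfolding MN_def by (intro Max_ge) auto

lemma abs_scalar_prod_le:
  assumes "x \<in> carrier_vec n" "y \<in> carrier_vec n"
  shows "\<bar>x \<bullet> y\<bar> \<le> vec_norm2 x * vec_norm2 y"
proof -
  have "\<bar>x \<bullet> y\<bar> \<le> (\<Sum>i<n. \<bar>x $ i\<bar> * \<bar>y $ i\<bar>)"
    using assms unfolding scalar_prod_def
    by (auto simp: lessThan_atLeast0 abs_mult intro!: order_trans[OF sum_abs])
  also have "\<dots> \<le> L2_set (\<lambda>i. x $ i) {..<n} * L2_set (\<lambda>i. y $ i) {..<n}"
    by (rule L2_set_mult_ineq)
  also have "\<dots> = vec_norm2 x * vec_norm2 y"
    using assms by (simp add: L2_set_def vec_norm2_def scalar_prod_def power2_eq_square lessThan_atLeast0)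
  finally show ?thesis .
qed

lemma Scov_nonneg: "2 \<le> N \<Longrightarrow> 0 \<le> Scov N Y q q"
  unfolding Scov_def by (intro divide_nonneg_nonneg sum_nonneg) auto

lemma Scov_eq_0_imp:
  assumes "2 \<le> N" "Scov N Y q q = 0" "i < N"
  shows "Y i q = Ybar N Y q"
proof -
  have "(\<Sum>i<N. (Y i q - Ybar N Y q) * (Y i q - Ybar N Y q)) = 0"
    using assms(1,2) by (simp add: Scov_def)
  then have "(Y i q - Ybar N Y q) * (Y i q - Ybar N Y q) = 0"
    using assms(3) by (subst (asm) sum_nonneg_eq_0_iff) auto
  then show ?thesis by simp
qed

text \<open>For S > 0, solving the hypothesis for |x| gives |x| / m \<le> \<sigma> / sqrt (m S). If
  S = 0, the quotient on the right is 0 by convention, and the left side is 0 because the outcomes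
  at level q are constant.\<close>

lemma term_le_loewner:
  assumes "2 \<le> N" "1 \<le> m" "i < N" "0 \<le> \<sigma>" and le: "x\<^sup>2 * (Scov N Y q q / real m) \<le> \<sigma>\<^sup>2"
  shows "\<bar>x\<bar> * \<bar>Y i q - Ybar N Y q\<bar> / real m
    \<le> \<sigma> * \<bar>Y i q - Ybar N Y q\<bar> / sqrt (real m * Scov N Y q q)"
proof (cases "Scov N Y q q = 0")
  case True
  then show ?thesis using Scov_eq_0_imp[OF assms(1) True assms(3)] by simp
next
  case False
  let ?S = "Scov N Y q q"
  have S: "0 < ?S" using Scov_nonneg[OF assms(1), of Y q] False by simp
  have m: "0 < real m" using assms(2) by simp
  have "(\<bar>x\<bar> * sqrt (real m * ?S))\<^sup>2 = x\<^sup>2 * (?S / real m) * (real m)\<^sup>2"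
    using S m by (simp add: power_mult_distrib) (simp add: power2_eq_square)
  also have "\<dots> \<le> \<sigma>\<^sup>2 * (real m)\<^sup>2" using le by (intro mult_right_mono) auto
  also have "\<dots> = (\<sigma> * real m)\<^sup>2" by (simp add: power_mult_distrib)
  finally have "\<bar>x\<bar> * sqrt (real m * ?S) \<le> \<sigma> * real m"
    by (rule power2_le_imp_le) (use assms(4) m in auto)
  then have "\<bar>x\<bar> / real m \<le> \<sigma> / sqrt (real m * ?S)"
    using S m by (simp add: field_simps)
  then have "\<bar>x\<bar> / real m * \<bar>Y i q - Ybar N Y q\<bar> \<le> \<sigma> / sqrt (real m * ?S) * \<bar>Y i q - Ybar N Y q\<bar>"
    by (rule mult_right_mono) simp
  then show ?thesis by simp
qed

theorem theorem1:
  "\<exists>C>0. \<forall>(N::nat) (Q::nat) (H::nat) (Nq::nat \<Rightarrow> nat) (Y::nat \<Rightarrow> nat \<Rightarrow> real) (F::real mat).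
     (\<forall>q<Q. Nq q \<ge> 1) \<longrightarrow> (\<Sum>q<Q. Nq q) = N \<longrightarrow> F \<in> carrier_mat Q H \<longrightarrow>
     invertible_mat (Vgamma N Q Nq Y F) \<longrightarrow>
     (\<forall>b \<in> carrier_vec H. vec_norm2 b = 1 \<longrightarrow> (\<forall>t::real.
        \<bar>measure_pmf.prob (CR N Q Nq) {Z. b \<bullet> gamma_tilde N Q Nq Y F Z \<le> t} - Phi t\<bar>
        \<le> C * vec_sup_norm (F *\<^sub>v (inv_sqrt_mat (Vgamma N Q Nq Y F) *\<^sub>v b))
            * Max ((\<lambda>q. MN N Y q / real (Nq q)) ` {..<Q})))
     \<and>
     (\<forall>\<sigma>F::real. \<sigma>F \<ge> 1 \<longrightarrow>
        loewner_le H (transpose_mat F * Dmat N Q Nq Y * F) (\<sigma>F\<^sup>2 \<cdot>\<^sub>m Vgamma N Q Nq Y F) \<longrightarrow>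
        (\<forall>b \<in> carrier_vec H. vec_norm2 b = 1 \<longrightarrow> (\<forall>t::real.
          \<bar>measure_pmf.prob (CR N Q Nq) {Z. b \<bullet> gamma_tilde N Q Nq Y F Z \<le> t} - Phi t\<bar>
          \<le> C * Max ((\<lambda>(i, q). min
                 (\<sigma>F * \<bar>Y i q - Ybar N Y q\<bar> / sqrt (real (Nq q) * Scov N Y q q))
                 (vec_norm2 (row F q) * \<bar>Y i q - Ybar N Y q\<bar> / real (Nq q)
                    / sqrt (rho_min (Vgamma N Q Nq Y F))))
               ` ({..<N} \<times> {..<Q})))))"
proof (intro exI[of _ "12 * (mills 0 + 3)"] conjI allI impI ballI)
  show "0 < 12 * (mills 0 + 3)" using mills_nonneg[of 0] by simp
next
  fix N Q H :: nat and Nq :: "nat \<Rightarrow> nat" and Y :: "nat \<Rightarrow> nat \<Rightarrow> real" and F :: "real mat"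
    and b :: "real vec" and t :: real
  assume pos: "\<forall>q<Q. 1 \<le> Nq q" and sum: "(\<Sum>q<Q. Nq q) = N" and F: "F \<in> carrier_mat Q H"
    and inv: "invertible_mat (Vgamma N Q Nq Y F)" and b: "b \<in> carrier_vec H" "vec_norm2 b = 1"
  define u where "u = inv_sqrt_mat (Vgamma N Q Nq Y F) *\<^sub>v b"
  note be = berry_esseen_gamma_tilde[OF pos sum F inv b u_def]
  let ?\<delta> = "vec_sup_norm (F *\<^sub>v u) * Max ((\<lambda>q. MN N Y q / real (Nq q)) ` {..<Q})"
  have "\<bar>measure_pmf.prob (CR N Q Nq) {Z. b \<bullet> gamma_tilde N Q Nq Y F Z \<le> t} - Phi t\<bar>
      \<le> 12 * (mills 0 + 3) * ?\<delta>"
  proof (rule be(4))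
    fix i q assume iq: "i < N" "q < Q"
    have "\<bar>(F *\<^sub>v u) $ q\<bar> \<le> vec_sup_norm (F *\<^sub>v u)"
      using F iq by (intro abs_le_vec_sup_norm) auto
    moreover have "\<bar>Y i q - Ybar N Y q\<bar> / real (Nq q) \<le> Max ((\<lambda>q. MN N Y q / real (Nq q)) ` {..<Q})"
    proof -
      have "\<bar>Y i q - Ybar N Y q\<bar> / real (Nq q) \<le> MN N Y q / real (Nq q)"
        by (intro divide_right_mono abs_le_MN iq) simp
      also have "\<dots> \<le> Max ((\<lambda>q. MN N Y q / real (Nq q)) ` {..<Q})"
        using iq by (intro Max_ge) auto
      finally show ?thesis .
    qed
    ultimately have "\<bar>(F *\<^sub>v u) $ q\<bar> * (\<bar>Y i q - Ybar N Y q\<bar> / real (Nq q)) \<le> ?\<delta>"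
      by (intro mult_mono) auto
    then show "\<bar>(F *\<^sub>v u) $ q\<bar> * \<bar>Y i q - Ybar N Y q\<bar> / real (Nq q) \<le> ?\<delta>" by simp
  qed
  then show "\<bar>measure_pmf.prob (CR N Q Nq) {Z. b \<bullet> gamma_tilde N Q Nq Y F Z \<le> t} - Phi t\<bar>
      \<le> 12 * (mills 0 + 3) * vec_sup_norm (F *\<^sub>v (inv_sqrt_mat (Vgamma N Q Nq Y F) *\<^sub>v b))
          * Max ((\<lambda>q. MN N Y q / real (Nq q)) ` {..<Q})"
    unfolding u_def by (simp only: mult.assoc)
next
  fix N Q H :: nat and Nq :: "nat \<Rightarrow> nat" and Y :: "nat \<Rightarrow> nat \<Rightarrow> real" and F :: "real mat"
    and \<sigma>F :: real and b :: "real vec" and t :: real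
  assume pos: "\<forall>q<Q. 1 \<le> Nq q" and sum: "(\<Sum>q<Q. Nq q) = N" and F: "F \<in> carrier_mat Q H"
    and inv: "invertible_mat (Vgamma N Q Nq Y F)" and \<sigma>: "1 \<le> \<sigma>F"
    and le: "loewner_le H (transpose_mat F * Dmat N Q Nq Y * F) (\<sigma>F\<^sup>2 \<cdot>\<^sub>m Vgamma N Q Nq Y F)"
    and b: "b \<in> carrier_vec H" "vec_norm2 b = 1"
  let ?V = "Vgamma N Q Nq Y F"
  define u where "u = inv_sqrt_mat ?V *\<^sub>v b"
  define c where "c = F *\<^sub>v u"
  note be = berry_esseen_gamma_tilde[OF pos sum F inv b u_def]
  note u = be(1) and one = be(2) and N = be(3)
  have c: "c \<in> carrier_vec Q" using F u by (simp add: c_def)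
  have V: "?V \<in> carrier_mat H H" by (rule Vgamma_carrier[OF F])
  have pd: "pos_def_mat H ?V" by (rule Vgamma_pos_def[OF pos sum F inv])
  \<comment> \<open>A vector of dimension 0 has norm 0, so the unit vector b forces H > 0, as the
    facts on \<open>rho_min\<close> require.\<close>
  have H: "0 < H" using b by (cases H) (auto simp: vec_norm2_def scalar_prod_def)
  \<comment> \<open>Condition 1 tested at u: the form of \<open>Dmat\<close> at c = F u is at most
    \<open>\<sigma>F\<^sup>2\<close> times u \<bullet> (V u) = 1. Its summands are nonnegative, so
    each of them obeys the same bound; this leads to the first alternative.\<close>
  have "(\<Sum>q<Q. (c $ q)\<^sup>2 * (Scov N Y q q / real (Nq q))) \<le> \<sigma>F\<^sup>2"
  proof -
    let ?G = "transpose_mat F * Dmat N Q Nq Y * F"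
    have G: "?G \<in> carrier_mat H H" using F Dmat_carrier[of N Q Nq Y] by simp
    have sV: "\<sigma>F\<^sup>2 \<cdot>\<^sub>m ?V \<in> carrier_mat H H" using V by simp
    have Gu: "?G *\<^sub>v u \<in> carrier_vec H" and Vu: "?V *\<^sub>v u \<in> carrier_vec H" using G V u by auto
    have "0 \<le> u \<bullet> ((\<sigma>F\<^sup>2 \<cdot>\<^sub>m ?V - ?G) *\<^sub>v u)" using le u by (simp add: loewner_le_def)
    also have "(\<sigma>F\<^sup>2 \<cdot>\<^sub>m ?V - ?G) *\<^sub>v u = \<sigma>F\<^sup>2 \<cdot>\<^sub>v (?V *\<^sub>v u) - ?G *\<^sub>v u"
      using minus_mult_distrib_mat_vec[OF sV G u] smult_mat_mult_vec[OF V u] by simp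
    also have "u \<bullet> \<dots> = \<sigma>F\<^sup>2 - u \<bullet> (?G *\<^sub>v u)"
      using u Gu Vu one by (simp add: scalar_prod_minus_distrib[of _ H])
    also have "u \<bullet> (?G *\<^sub>v u) = (\<Sum>q<Q. (c $ q)\<^sup>2 * (Scov N Y q q / real (Nq q)))"
      unfolding congruence_quadratic_form[OF F Dmat_carrier u] c_def[symmetric]
      by (rule Dmat_quadratic_form[OF c])
    finally show ?thesis by simp
  qed
  moreover have "(c $ q)\<^sup>2 * (Scov N Y q q / real (Nq q)) \<le> (\<Sum>q<Q. (c $ q)\<^sup>2 * (Scov N Y q q / real (Nq q)))"
    if "q < Q" for q
    using that Scov_nonneg[OF N] by (intro member_le_sum) auto
  ultimately have cS: "(c $ q)\<^sup>2 * (Scov N Y q q / real (Nq q)) \<le> \<sigma>F\<^sup>2" if "q < Q" for q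
    using that by force
  have \<rho>: "0 < rho_min ?V" by (rule rho_min_rayleigh(1)[OF V Vgamma_sym[OF F] pd H])
  \<comment> \<open>The second alternative: u \<bullet> (V u) = 1 and the Rayleigh bound limit the
    length of u, and Cauchy-Schwarz against row q of F then limits \<open>c $ q\<close>.\<close>
  have "rho_min ?V * (u \<bullet> u) \<le> 1"
    using rho_min_rayleigh(2)[OF V Vgamma_sym[OF F] pd H u] one by simp
  then have nu: "vec_norm2 u \<le> 1 / sqrt (rho_min ?V)"
    unfolding vec_norm2_def using \<rho> by (simp add: real_sqrt_divide[symmetric] field_simps flip: real_sqrt_mult)
  have cF: "\<bar>c $ q\<bar> \<le> vec_norm2 (row F q) / sqrt (rho_min ?V)" if "q < Q" for q
  proof -
    have "\<bar>c $ q\<bar> = \<bar>row F q \<bullet> u\<bar>" using F that by (simp add: c_def)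
    also have "\<dots> \<le> vec_norm2 (row F q) * vec_norm2 u"
      using F u that by (intro abs_scalar_prod_le[of _ H]) auto
    also have "\<dots> \<le> vec_norm2 (row F q) * (1 / sqrt (rho_min ?V))"
      by (rule mult_left_mono[OF nu])
         (simp add: vec_norm2_def scalar_prod_def sum_nonneg)
    finally show ?thesis by simp
  qed
  let ?f = "\<lambda>(i, q). min (\<sigma>F * \<bar>Y i q - Ybar N Y q\<bar> / sqrt (real (Nq q) * Scov N Y q q))
                 (vec_norm2 (row F q) * \<bar>Y i q - Ybar N Y q\<bar> / real (Nq q) / sqrt (rho_min ?V))"
  show "\<bar>measure_pmf.prob (CR N Q Nq) {Z. b \<bullet> gamma_tilde N Q Nq Y F Z \<le> t} - Phi t\<bar>
      \<le> 12 * (mills 0 + 3) * Max (?f ` ({..<N} \<times> {..<Q}))"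
  proof (rule be(4))
    fix i q assume iq: "i < N" "q < Q"
    have "\<bar>c $ q\<bar> * \<bar>Y i q - Ybar N Y q\<bar> / real (Nq q)
        \<le> \<sigma>F * \<bar>Y i q - Ybar N Y q\<bar> / sqrt (real (Nq q) * Scov N Y q q)"
      by (rule term_le_loewner[OF N _ iq(1) _ cS[OF iq(2)]]) (use pos iq \<sigma> in auto)
    moreover have "\<bar>c $ q\<bar> * (\<bar>Y i q - Ybar N Y q\<bar> / real (Nq q))
        \<le> vec_norm2 (row F q) / sqrt (rho_min ?V) * (\<bar>Y i q - Ybar N Y q\<bar> / real (Nq q))"
      by (rule mult_right_mono[OF cF[OF iq(2)]]) simp
    ultimately have "\<bar>c $ q\<bar> * \<bar>Y i q - Ybar N Y q\<bar> / real (Nq q) \<le> ?f (i, q)"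
      by (simp add: mult_ac)
    also have "\<dots> \<le> Max (?f ` ({..<N} \<times> {..<Q}))"
      using iq by (intro Max_ge) auto
    finally show "\<bar>(F *\<^sub>v u) $ q\<bar> * \<bar>Y i q - Ybar N Y q\<bar> / real (Nq q) \<le> Max (?f ` ({..<N} \<times> {..<Q}))"
      unfolding c_def .
  qed
qed

end
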